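(* Let $(f_n)$ be a sequence of functions with the Baire property from a Polish space $(X,d)$ to a complete metric space $(Z,\rho)$. Assume that $\mathcal I$ is an ideal on $\mathbb N$ which is either analytic or coanalytic. Then the following conditions are equivalent: (i) the set $\{x \in X \colon (f_n(x)) \text{ is divergent}\}$ is comeager in $X$; (ii) the set $\{x \in X \colon\{s \in S \colon (f_{s(n)}(x)) \text{ is } \mathcal I\text{-convergent}\} \text{ is meager in } S\}$ is comeager in $X$; (iii) the set $\{(x,s) \in X \times S \colon (f_{s(n)}(x)) \text{ is } \mathcal I\text{-convergent}\}$ is meager in $X\times S$; (iv) the set $\{s \in S \colon \{x \in X \colon (f_{s(n)}(x)) \text{ is } \mathcal I\text{-convergent}\} \text{ is meager in } X\}$ is comeager in $S$.
   Context: $\mathbb N=\{1,2,\dots\}$. $S:=\{ s\in\mathbb N^{\mathbb N}\colon \forall n\in\mathbb N\; s(n)<s(n+1)\}$ with the subspace topology inherited from $\mathbb N^{\mathbb N}$ (product of discrete spaces); it is a $G_\delta$ subset of $\mathbb N^{\mathbb N}$, hence a Polish space. All ideals are assumed admissible: an ideal on $\mathbb N$ is an ideal $\mathcal I\subset\mathcal P(\mathbb N)$ (a family closed under subsets and finite unions) such that $\mathbb N\notin\mathcal I$ and every finite subset of $\mathbb N$ belongs to $\mathcal I$. Via characteristic functions, $\mathcal I$ is regarded as a subset of the Polish space $\{0,1\}^{\mathbb N}$; "analytic" and "coanalytic" refer to this space. A sequence $(z_n)$ in a metric space $(Z,\rho)$ is $\mathcal I$-convergent to $z\in Z$ if for every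 $\varepsilon>0$ we have $\{n\in\mathbb N\colon \rho(z_n,z)\ge\varepsilon\}\in\mathcal I$; it is $\mathcal I$-convergent if it is $\mathcal I$-convergent to some $z\in Z$. "Divergent" means not convergent (in the usual sense) to any point of $Z$. Sets with the Baire property in a metric space form the smallest $\sigma$-algebra containing the open sets and the meager sets. A mapping from a metric space $X$ to a metric space $Z$ has the Baire property if the preimage of any open set in $Z$ has the Baire property in $X$. *)

theory Defs
  imports "HOL-Analysis.Analysis"
begin

definition nowhere_dense_in :: "'a topology \<Rightarrow> 'a set \<Rightarrow> bool" where
  "nowhere_dense_in T A \<longleftrightarrow> A \<subseteq> topspace T \<and> T interior_of (T closure_of A) = {}"

definition meager_in :: "'a topology \<Rightarrow> 'a set \<Rightarrow> bool" where
  "meager_in T A \<longleftrightarrow> (\<exists>N :: nat \<Rightarrow> 'a set. (\<forall>n. nowhere_dense_in T (N n)) \<and> A = (\<Union>n. N n))"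

definition comeager_in :: "'a topology \<Rightarrow> 'a set \<Rightarrow> bool" where
  "comeager_in T A \<longleftrightarrow> A \<subseteq> topspace T \<and> meager_in T (topspace T - A)"

definition baire_sets :: "'a topology \<Rightarrow> 'a set set" where
  "baire_sets T = sigma_sets (topspace T) ({U. openin T U} \<union> {M. meager_in T M})"

definition has_baire_property :: "('a::topological_space \<Rightarrow> 'b::topological_space) \<Rightarrow> bool" where
  "has_baire_property g \<longleftrightarrow> (\<forall>U. open U \<longrightarrow> g -` U \<in> baire_sets euclidean)"

(* For use in Polish spaces only (bool has no metric_space instance, so the sort is weaker).
   Analytic sets: the empty set and the continuous images of the Baire
   space.  Here nat => nat carries its type class topology, the product of discrete spaces. *)
definition analytic :: "'a::topological_space set \<Rightarrow> bool" where
  "analytic A \<longleftrightarrow> A = {} \<or> (\<exists>g :: (nat \<Rightarrow> nat) \<Rightarrow> 'a. continuous_on UNIV g \<and> A = range g)"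

definition coanalytic :: "'a::topological_space set \<Rightarrow> bool" where
  "coanalytic A \<longleftrightarrow> analytic (- A)"

(* The index set {1,2,...} is rendered as the type nat, via the shift n |-> n - 1. *)
definition admissible_ideal :: "nat set set \<Rightarrow> bool" where
  "admissible_ideal I \<longleftrightarrow>
     (\<forall>A\<in>I. \<forall>B. B \<subseteq> A \<longrightarrow> B \<in> I) \<and>
     (\<forall>A\<in>I. \<forall>B\<in>I. A \<union> B \<in> I) \<and>
     UNIV \<notin> I \<and>
     (\<forall>A. finite A \<longrightarrow> A \<in> I)"

(* A family of sets of naturals as a subset of the Cantor space nat => bool. *)
definition char_funs :: "nat set set \<Rightarrow> (nat \<Rightarrow> bool) set" where
  "char_funs I = (\<lambda>A n. n \<in> A) ` I"

definition ideal_convergent_to :: "nat set set \<Rightarrow> (nat \<Rightarrow> 'b::metric_space) \<Rightarrow> 'b \<Rightarrow> bool" where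
  "ideal_convergent_to I u z \<longleftrightarrow> (\<forall>e>0. {n. dist (u n) z \<ge> e} \<in> I)"

definition ideal_convergent :: "nat set set \<Rightarrow> (nat \<Rightarrow> 'b::metric_space) \<Rightarrow> bool" where
  "ideal_convergent I u \<longleftrightarrow> (\<exists>z. ideal_convergent_to I u z)"

definition incr_seqs :: "(nat \<Rightarrow> nat) set" where
  "incr_seqs = {s. \<forall>n. s n < s (Suc n)}"

end

(* Only the step from (i) to (iii) is substantial: if all f n x converge, then so does every
   subsequence, so each of (ii) and (iv) gives (i); (iii) gives (iv) by the Kuratowski-Ulam argument;
   and (ii) follows from (iv) for the sequences of constant functions f n x.

   An analytic or coanalytic ideal has the Baire property, hence is meager, and there are blocks
   of consecutive integers such that no set of I contains infinitely many of them. For x with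
   (f n x) not Cauchy, every finite increasing sequence can be extended so that on a whole block the
   values f (s n) x stay away from f (s N) x. This condition is open in s, and open in x up to a
   meager set provided that the sets {x. dist (f i x) (f j x) >= e} have the Baire property; hence
   the set in (iii) is meager.

   As Z need not be separable, that proviso requires that functions with the Baire property have
   essentially separable range. This rests on the fact that a partition of a nonmeager subset of a
   Polish space into meager sets has a union of parts without the Baire property, which is
   proved with a Bernstein set. *)

theory Submission
  imports Defs
begin


section \<open>Meager sets and sets with the Baire property\<close>

text \<open>Meagerness in (iii) calls for a countable cover, while an ideal limit ranges over all of
  \<open>Z\<close>. So the limit is traded for a term \<open>u N\<close> within e/2 of it. What is
  kept of ideal convergence is that every late block contains an index n with \<open>u n\<close>
  within e of \<open>u N\<close>; the scale e, the index \<open>N\<close> and the place where "late"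
  begins can then be taken from countable sets. To violate this condition for one late block only
  finitely many further entries of the index sequence must be chosen, and this is what makes each
  set of the cover nowhere dense. Since the triples of a scale and two indices are countable too,
  replacing all the sets {x. dist (f i x) (f j x) >= e} by open ones costs a single meager set of
  exceptional x.\<close>

lemma nowhere_dense_inI:
  assumes "A \<subseteq> topspace T"
    and *: "\<And>V. openin T V \<Longrightarrow> V \<noteq> {} \<Longrightarrow> \<exists>V'. openin T V' \<and> V' \<noteq> {} \<and> V' \<subseteq> V \<and> V' \<inter> A = {}"
  shows "nowhere_dense_in T A"
proof -
  have False if ne: "T interior_of (T closure_of A) \<noteq> {}"
  proof -
    obtain V' where V': "openin T V'" "V' \<noteq> {}" "V' \<subseteq> T interior_of (T closure_of A)" "V' \<inter> A = {}"
      using *[OF openin_interior_of ne] by blast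
    have "V' \<inter> T closure_of A = {}"
      using V' by (simp add: openin_Int_closure_of_eq_empty)
    then show False
      using V' interior_of_subset[of T "T closure_of A"] by blast
  qed
  then show ?thesis
    using assms(1) by (auto simp: nowhere_dense_in_def)
qed

lemma nowhere_dense_inD:
  assumes "nowhere_dense_in T A" "openin T V" "V \<noteq> {}"
  shows "\<exists>V'. openin T V' \<and> V' \<noteq> {} \<and> V' \<subseteq> V \<and> V' \<inter> A = {}"
proof -
  let ?V' = "V - T closure_of A"
  have "\<not> V \<subseteq> T closure_of A"
    using assms by (metis interior_of_maximal nowhere_dense_in_def subset_empty)
  moreover have "openin T ?V'"
    using assms(2) by (simp add: openin_diff)
  moreover have "A \<subseteq> T closure_of A"
    using assms(1) by (simp add: closure_of_subset nowhere_dense_in_def)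
  ultimately show ?thesis
    by (intro exI[of _ ?V']) auto
qed

lemma nowhere_dense_in_subset:
  "nowhere_dense_in T B \<Longrightarrow> A \<subseteq> B \<Longrightarrow> nowhere_dense_in T A"
  unfolding nowhere_dense_in_def
  by (metis closure_of_mono dual_order.trans interior_of_mono subset_empty)

lemma nowhere_dense_in_closure:
  "nowhere_dense_in T A \<Longrightarrow> nowhere_dense_in T (T closure_of A)"
  by (simp add: nowhere_dense_in_def closure_of_subset_topspace)

lemma nowhere_dense_in_Un:
  assumes "nowhere_dense_in T A" "nowhere_dense_in T B"
  shows "nowhere_dense_in T (A \<union> B)"
proof (rule nowhere_dense_inI)
  show "A \<union> B \<subseteq> topspace T"
    using assms by (auto simp: nowhere_dense_in_def)
next
  fix V assume "openin T V" "V \<noteq> {}"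
  then obtain V' where V': "openin T V'" "V' \<noteq> {}" "V' \<subseteq> V" "V' \<inter> A = {}"
    using nowhere_dense_inD[OF assms(1)] by blast
  obtain V'' where "openin T V''" "V'' \<noteq> {}" "V'' \<subseteq> V'" "V'' \<inter> B = {}"
    using nowhere_dense_inD[OF assms(2) V'(1,2)] by blast
  then show "\<exists>V'. openin T V' \<and> V' \<noteq> {} \<and> V' \<subseteq> V \<and> V' \<inter> (A \<union> B) = {}"
    using V' by blast
qed

lemma nowhere_dense_in_empty: "nowhere_dense_in T {}"
  by (simp add: nowhere_dense_in_def)

lemma nowhere_dense_imp_meager: "nowhere_dense_in T A \<Longrightarrow> meager_in T A"
  unfolding meager_in_def by (rule exI[of _ "\<lambda>_. A"]) auto

lemma meager_in_empty: "meager_in T {}"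
  by (simp add: nowhere_dense_in_empty nowhere_dense_imp_meager)

lemma meager_in_subset:
  assumes "meager_in T B" "A \<subseteq> B" shows "meager_in T A"
proof -
  obtain N :: "nat \<Rightarrow> _" where N: "\<forall>n. nowhere_dense_in T (N n)" "B = (\<Union>n. N n)"
    using assms(1) by (auto simp: meager_in_def)
  then show ?thesis
    unfolding meager_in_def using assms(2)
    by (intro exI[of _ "\<lambda>n. N n \<inter> A"]) (auto intro: nowhere_dense_in_subset)
qed

lemma meager_in_UN_nat:
  assumes "\<And>n::nat. meager_in T (A n)" shows "meager_in T (\<Union>n. A n)"
proof -
  obtain N :: "nat \<Rightarrow> nat \<Rightarrow> _" where N: "\<And>n m. nowhere_dense_in T (N n m)" "\<And>n. A n = (\<Union>m. N n m)"
    using assms unfolding meager_in_def by metis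
  have "(\<Union>n. A n) = (\<Union>k. case prod_decode k of (n, m) \<Rightarrow> N n m)"
  proof (intro equalityI subsetI)
    fix x assume "x \<in> (\<Union>n. A n)"
    then obtain n m where "x \<in> N n m" using N by auto
    then show "x \<in> (\<Union>k. case prod_decode k of (n, m) \<Rightarrow> N n m)"
      by (intro UN_I[of "prod_encode (n, m)"]) auto
  next
    fix x assume "x \<in> (\<Union>k. case prod_decode k of (n, m) \<Rightarrow> N n m)"
    then show "x \<in> (\<Union>n. A n)"
      using N(2) by (auto split: prod.splits) (metis UN_I UNIV_I surj_pair)
  qed
  then show ?thesis
    unfolding meager_in_def using N(1)
    by (intro exI[of _ "\<lambda>k. case prod_decode k of (n, m) \<Rightarrow> N n m"]) (auto split: prod.splits)
qed

lemma meager_in_UN: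
  assumes "countable K" "\<And>k. k \<in> K \<Longrightarrow> meager_in T (A k)" shows "meager_in T (\<Union>k\<in>K. A k)"
proof (cases "K = {}")
  case False
  then have "(\<Union>k\<in>K. A k) = (\<Union>n. A (from_nat_into K n))"
    using assms(1) by (metis UN_extend_simps(10) range_from_nat_into)
  then show ?thesis
    using meager_in_UN_nat[of T "\<lambda>n. A (from_nat_into K n)"] assms from_nat_into[OF False] by auto
qed (simp add: meager_in_empty)

lemma meager_in_Un:
  assumes "meager_in T A" "meager_in T B" shows "meager_in T (A \<union> B)"
  using meager_in_UN[of "{A, B}" T id] assms by auto

text \<open>Closures of nowhere dense sets stay nowhere dense. Closed pieces have open complements,
  as required by the Baire category theorem, by the construction of G-delta subsets and by the
  argument on sections.\<close>

lemma meager_in_fsigma_hull: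
  assumes "meager_in T A"
  obtains N :: "nat \<Rightarrow> 'a set"
  where "\<And>n. closedin T (N n)" "\<And>n. nowhere_dense_in T (N n)" "A \<subseteq> (\<Union>n. N n)"
proof -
  obtain N :: "nat \<Rightarrow> 'a set" where N: "\<forall>n. nowhere_dense_in T (N n)" "A = (\<Union>n. N n)"
    using assms by (auto simp: meager_in_def)
  have "N n \<subseteq> T closure_of N n" for n
    using N(1) by (simp add: closure_of_subset nowhere_dense_in_def)
  then have "A \<subseteq> (\<Union>n. T closure_of N n)"
    using N(2) by blast
  then show thesis
    using N(1) by (intro that[of "\<lambda>n. T closure_of N n"]) (auto intro: nowhere_dense_in_closure)
qed

lemma meager_in_Times:
  assumes "meager_in T A" shows "meager_in (prod_topology T T') (A \<times> topspace T')"
proof -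
  obtain N :: "nat \<Rightarrow> _" where N: "\<forall>n. nowhere_dense_in T (N n)" "A = (\<Union>n. N n)"
    using assms by (auto simp: meager_in_def)
  have "nowhere_dense_in (prod_topology T T') (N n \<times> topspace T')" for n
    using N(1) by (auto simp: nowhere_dense_in_def closure_of_Times interior_of_Times)
  moreover have "A \<times> topspace T' = (\<Union>n. N n \<times> topspace T')"
    using N(2) by auto
  ultimately show ?thesis
    unfolding meager_in_def by (intro exI[of _ "\<lambda>n. N n \<times> topspace T'"]) simp
qed

lemma not_meager_open:
  assumes "completely_metrizable_space T" "openin T U" "U \<noteq> {}"
  shows "\<not> meager_in T U"
proof
  assume "meager_in T U"
  then obtain N :: "nat \<Rightarrow> _" where N: "\<And>n. closedin T (N n)" "\<And>n. nowhere_dense_in T (N n)"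
    "U \<subseteq> (\<Union>n. N n)"
    by (rule meager_in_fsigma_hull) blast
  have "T interior_of \<Union>(range N) = {}"
    using assms(1) N(1,2)
    by (intro Baire_category_alt) (auto simp: nowhere_dense_in_def closure_of_closedin)
  then show False
    using assms(2,3) N(3) interior_of_maximal by fastforce
qed

text \<open>The classical equivalent of the Baire property; unlike membership in a generated
  sigma-algebra it hands a proof a concrete open set.\<close>

definition almost_open :: "'a::topological_space set \<Rightarrow> bool" where
  "almost_open A \<longleftrightarrow> (\<exists>U. open U \<and> meager_in euclidean ((A - U) \<union> (U - A)))"

lemma almost_open_open: "open U \<Longrightarrow> almost_open U"
  unfolding almost_open_def by (intro exI[of _ U]) (auto simp: meager_in_empty)

lemma almost_open_meager: "meager_in euclidean M \<Longrightarrow> almost_open M"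
  unfolding almost_open_def by (intro exI[of _ "{}"]) auto

lemma almost_open_cong_meager:
  assumes "almost_open A" "meager_in euclidean M" "A - M = B - M"
  shows "almost_open B"
proof -
  obtain U where U: "open U" "meager_in euclidean ((A - U) \<union> (U - A))"
    using assms(1) by (auto simp: almost_open_def)
  have "meager_in euclidean ((B - U) \<union> (U - B))"
    by (rule meager_in_subset[OF meager_in_Un[OF U(2) assms(2)]]) (use assms(3) in blast)
  with U(1) show ?thesis by (auto simp: almost_open_def)
qed

lemma nowhere_dense_boundary:
  assumes "open U" shows "nowhere_dense_in euclidean (closure U - U)"
proof (rule nowhere_dense_inI)
  fix V :: "'a set" assume V: "openin euclidean V" "V \<noteq> {}"
  show "\<exists>V'. openin euclidean V' \<and> V' \<noteq> {} \<and> V' \<subseteq> V \<and> V' \<inter> (closure U - U) = {}"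
  proof (cases "V \<inter> U = {}")
    case True
    then have "V \<inter> closure U = {}" using V(1) open_Int_closure_eq_empty open_openin by blast
    then show ?thesis using V by blast
  next
    case False
    then show ?thesis using V assms by (intro exI[of _ "V \<inter> U"]) auto
  qed
qed simp

text \<open>The complement is approximated by \<open>- closure U\<close>, and the error grows only
  by the nowhere dense boundary of \<open>U\<close>.\<close>

lemma almost_open_Compl:
  assumes "almost_open A" shows "almost_open (- A)"
proof -
  obtain U where U: "open U" "meager_in euclidean ((A - U) \<union> (U - A))"
    using assms by (auto simp: almost_open_def)
  have "meager_in euclidean (((A - U) \<union> (U - A)) \<union> (closure U - U))"
    using meager_in_Un[OF U(2) nowhere_dense_imp_meager[OF nowhere_dense_boundary[OF U(1)]]] .
  then have "meager_in euclidean ((- A - (- closure U)) \<union> (- closure U - (- A)))"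
    by (rule meager_in_subset) (use closure_subset in blast)
  then show ?thesis
    unfolding almost_open_def by (meson closed_closure open_Compl)
qed

lemma almost_open_UN:
  assumes "countable K" "\<And>k. k \<in> K \<Longrightarrow> almost_open (A k)" shows "almost_open (\<Union>k\<in>K. A k)"
proof -
  obtain U where U: "\<And>k. k \<in> K \<Longrightarrow> open (U k)"
    "\<And>k. k \<in> K \<Longrightarrow> meager_in euclidean ((A k - U k) \<union> (U k - A k))"
    using assms(2) unfolding almost_open_def by metis
  have "meager_in euclidean (\<Union>k\<in>K. (A k - U k) \<union> (U k - A k))"
    using assms(1) U by (intro meager_in_UN)
  then have "meager_in euclidean (((\<Union>k\<in>K. A k) - (\<Union>k\<in>K. U k)) \<union> ((\<Union>k\<in>K. U k) - (\<Union>k\<in>K. A k)))"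
    by (rule meager_in_subset) blast
  then show ?thesis
    unfolding almost_open_def using U(1) by blast
qed

lemma almost_open_Un: "almost_open A \<Longrightarrow> almost_open B \<Longrightarrow> almost_open (A \<union> B)"
  using almost_open_UN[of "{A, B}" id] by auto

lemma almost_open_Int:
  assumes "almost_open A" "almost_open B" shows "almost_open (A \<inter> B)"
  using almost_open_Compl[OF almost_open_Un[OF assms[THEN almost_open_Compl]]] by simp

lemma almost_open_Diff: "almost_open A \<Longrightarrow> almost_open B \<Longrightarrow> almost_open (A - B)"
  by (simp add: Diff_eq almost_open_Compl almost_open_Int)

lemma baire_sets_imp_almost_open:
  assumes "A \<in> baire_sets euclidean" shows "almost_open A"
  using assms unfolding baire_sets_def
proof (induction rule: sigma_sets.induct)
  case (Basic A)
  then show ?case by (auto intro: almost_open_open almost_open_meager)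
next
  case Empty
  show ?case by (simp add: almost_open_open)
next
  case (Compl A)
  then show ?case using almost_open_Compl by (simp add: Compl_eq_Diff_UNIV)
next
  case (Union A)
  then show ?case by (intro almost_open_UN) auto
qed

text \<open>The error being meager, the approximating open set cannot be meager. This localisation,
  from nonmeager to comeager in an open set, starts most of the contradictions below.\<close>

lemma almost_open_nonmeager:
  assumes "almost_open A" "\<not> meager_in euclidean A"
  obtains V where "open V" "\<not> meager_in euclidean V" "meager_in euclidean (V - A)"
proof -
  obtain U where U: "open U" "meager_in euclidean ((A - U) \<union> (U - A))"
    using assms(1) by (auto simp: almost_open_def)
  have "\<not> meager_in euclidean U"
  proof
    assume "meager_in euclidean U"
    from meager_in_Un[OF this U(2)] have "meager_in euclidean A"
      by (rule meager_in_subset) blast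
    with assms(2) show False ..
  qed
  moreover have "meager_in euclidean (U - A)"
    using U(2) by (rule meager_in_subset) blast
  ultimately show thesis
    using U(1) that by blast
qed


section \<open>Analytic sets have the Baire property\<close>

definition cylinder :: "(nat \<Rightarrow> 'b) \<Rightarrow> nat \<Rightarrow> (nat \<Rightarrow> 'b) set" where
  "cylinder x n = {y. \<forall>i<n. y i = x i}"

lemma open_cylinder: "open (cylinder (x :: nat \<Rightarrow> 'b::discrete_topology) n)"
proof -
  have "open {f. \<forall>i\<in>{..<n}. f i \<in> {x i}}"
    by (intro product_topology_basis') (auto simp: open_discrete)
  then show ?thesis by (simp add: cylinder_def lessThan_def)
qed

lemma cylinder_subset_open:
  fixes x :: "nat \<Rightarrow> 'b::discrete_topology"
  assumes "open W" "x \<in> W"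
  obtains n where "cylinder x n \<subseteq> W"
proof -
  have "openin (product_topology (\<lambda>_. euclidean) UNIV) W"
    using assms(1) by (simp add: open_fun_def)
  then have "\<exists>X. x \<in> (\<Pi>\<^sub>E i\<in>UNIV. X i) \<and> (\<forall>i. openin (euclidean :: 'b topology) (X i)) \<and>
      finite {i. X i \<noteq> topspace (euclidean :: 'b topology)} \<and> (\<Pi>\<^sub>E i\<in>UNIV. X i) \<subseteq> W"
    using product_topology_open_contains_basis
      [where T = "\<lambda>_::nat. euclidean :: 'b topology" and I = UNIV and U = W and x = x] assms(2)
    by simp
  then obtain X where X: "x \<in> (\<Pi>\<^sub>E i\<in>UNIV. X i)"
    "finite {i. X i \<noteq> topspace (euclidean :: 'b topology)}" "(\<Pi>\<^sub>E i\<in>UNIV. X i) \<subseteq> W"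
    by blast
  obtain n where n: "\<And>i. X i \<noteq> UNIV \<Longrightarrow> i < n"
  proof -
    have "\<exists>n. \<forall>i\<in>{i. X i \<noteq> UNIV}. i < n"
      using X(2) unfolding finite_nat_set_iff_bounded by simp
    then show thesis using that by auto
  qed
  have "cylinder x n \<subseteq> (\<Pi>\<^sub>E i\<in>UNIV. X i)"
  proof
    fix y assume y: "y \<in> cylinder x n"
    have "y i \<in> X i" for i
    proof (cases "X i = UNIV")
      case False
      then have "y i = x i" using n y by (simp add: cylinder_def)
      then show ?thesis using PiE_mem[OF X(1), of i] by simp
    qed simp
    then show "y \<in> (\<Pi>\<^sub>E i\<in>UNIV. X i)" by (intro PiE_I) auto
  qed
  from order_trans[OF this X(3)] show thesis by (rule that)
qed

lemma countable_cylinders: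
  "countable {cylinder (x :: nat \<Rightarrow> 'b::countable) n | x n. True}"
proof -
  \<comment> \<open>\<open>(!) l\<close> is unspecified beyond the length of \<open>l\<close>, but
    the cylinder reads only the first \<open>n\<close> entries.\<close>
  let ?f = "\<lambda>(l :: 'b list, n). cylinder ((!) l) n"
  have cyl: "cylinder x n = ?f (map x [0..<n], n)" for x :: "nat \<Rightarrow> 'b" and n
    by (simp add: cylinder_def)
  have "{cylinder (x :: nat \<Rightarrow> 'b) n | x n. True} \<subseteq> range ?f"
  proof
    fix C assume "C \<in> {cylinder (x :: nat \<Rightarrow> 'b) n | x n. True}"
    then obtain x :: "nat \<Rightarrow> 'b" and n where "C = cylinder x n" by blast
    with cyl show "C \<in> range ?f" by (metis rangeI)
  qed
  then show ?thesis by (rule countable_subset) simp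
qed

lemma second_countable_Cantor: "second_countable (euclidean :: (nat \<Rightarrow> bool) topology)"
  unfolding second_countable_def
proof (intro exI conjI ballI allI impI)
  let ?B = "{cylinder (x :: nat \<Rightarrow> bool) n | x n. True}"
  show "countable ?B" by (rule countable_cylinders)
  show "openin euclidean V" if "V \<in> ?B" for V
    using that by (auto simp: open_cylinder)
  fix U and x :: "nat \<Rightarrow> bool" assume "openin euclidean U \<and> x \<in> U"
  then obtain n where "cylinder x n \<subseteq> U"
    using cylinder_subset_open[of U x] by auto
  then show "\<exists>V\<in>?B. x \<in> V \<and> V \<subseteq> U"
    by (intro bexI[of _ "cylinder x n"]) (auto simp: cylinder_def)
qed

lemma completely_metrizable_discrete_sequences:
  "completely_metrizable_space (euclidean :: (nat \<Rightarrow> 'b::discrete_topology) topology)"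
proof -
  have "(euclidean :: 'b topology) = discrete_topology UNIV"
    by (simp add: topology_eq open_discrete)
  then have "completely_metrizable_space (product_topology (\<lambda>_::nat. euclidean :: 'b topology) UNIV)"
    by (simp add: completely_metrizable_space_product_topology completely_metrizable_space_discrete_topology)
  then show ?thesis by (simp add: euclidean_product_topology)
qed

section \<open>Kuratowski's localisation modulo meager sets, and Nikodym's theorem\<close>

definition nonmeager_points :: "'a::topological_space set \<Rightarrow> 'a set" where
  "nonmeager_points A = {x. \<forall>V. open V \<longrightarrow> x \<in> V \<longrightarrow> \<not> meager_in euclidean (A \<inter> V)}"

lemma closed_nonmeager_points: "closed (nonmeager_points A)"
proof -
  have "- nonmeager_points A = \<Union>{V. open V \<and> meager_in euclidean (A \<inter> V)}"
    by (auto simp: nonmeager_points_def)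
  then have "open (- nonmeager_points A)" by auto
  then show ?thesis by (simp add: closed_def)
qed

lemma nonmeager_points_subset_closure: "nonmeager_points A \<subseteq> closure A"
proof
  fix x assume x: "x \<in> nonmeager_points A"
  show "x \<in> closure A"
  proof (rule ccontr)
    assume "x \<notin> closure A"
    then have "\<not> meager_in euclidean (A \<inter> - closure A)"
      using x closed_closure[of A] by (auto simp: nonmeager_points_def closed_def simp del: closed_closure)
    moreover have "A \<inter> - closure A = {}"
      using closure_subset by blast
    ultimately show False by (simp add: meager_in_empty)
  qed
qed

text \<open>The points at which \<open>A\<close> is locally meager are covered by those basic open
  sets in which \<open>A\<close> is meager, and there are countably many of these.\<close>

lemma meager_Diff_nonmeager_points:
  assumes "second_countable (euclidean :: 'a::topological_space topology)"
  shows "meager_in euclidean ((A :: 'a set) - nonmeager_points A)"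
proof -
  have "\<exists>B :: 'a set set. countable B \<and> (\<forall>U x. open U \<and> x \<in> U \<longrightarrow> (\<exists>V\<in>B. x \<in> V \<and> V \<subseteq> U))"
    using assms unfolding second_countable_def open_openin[symmetric] by blast
  then obtain B :: "'a set set" where B: "countable B"
    "\<forall>U x. open U \<and> x \<in> U \<longrightarrow> (\<exists>V\<in>B. x \<in> V \<and> V \<subseteq> U)"
    by blast
  let ?B = "{V\<in>B. meager_in euclidean (A \<inter> V)}"
  have "A - nonmeager_points A \<subseteq> (\<Union>V\<in>?B. A \<inter> V)"
  proof
    fix x assume "x \<in> A - nonmeager_points A"
    then obtain U where U: "open U" "x \<in> U" "meager_in euclidean (A \<inter> U)" "x \<in> A"
      by (auto simp: nonmeager_points_def)
    then obtain V where "V \<in> B" "x \<in> V" "V \<subseteq> U" using B(2) by blast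
    moreover from this have "meager_in euclidean (A \<inter> V)"
      by (intro meager_in_subset[OF U(3)]) auto
    ultimately show "x \<in> (\<Union>V\<in>?B. A \<inter> V)" using U(4) by blast
  qed
  moreover have "meager_in euclidean (\<Union>V\<in>?B. A \<inter> V)"
    using B(1) by (intro meager_in_UN) auto
  ultimately show ?thesis by (rule meager_in_subset[rotated])
qed

text \<open>The closed set \<open>nonmeager_points A\<close> is, up to a meager set, the least set with the Baire
  property containing \<open>A\<close>; hence it commutes with countable unions up to a meager set.\<close>

lemma meager_nonmeager_points_UN:
  assumes sc: "second_countable (euclidean :: 'a::topological_space topology)"
    and A: "A = (\<Union>n::nat. A' n)"
  shows "meager_in euclidean (nonmeager_points (A :: 'a set) - (\<Union>n. nonmeager_points (A' n)))"
    (is "meager_in _ ?Q")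
proof (rule ccontr)
  assume nonmeager: "\<not> meager_in euclidean ?Q"
  have "almost_open (nonmeager_points B)" for B :: "'a set"
    using almost_open_Compl[OF almost_open_open, of "- nonmeager_points B"] closed_nonmeager_points[of B]
    by auto
  then have "almost_open ?Q"
    by (intro almost_open_Diff almost_open_UN) auto
  then obtain V where V: "open V" "\<not> meager_in euclidean V" "meager_in euclidean (V - ?Q)"
    using nonmeager by (rule almost_open_nonmeager)
  \<comment> \<open>Inside \<open>?Q\<close> no point is a nonmeager point of any
    \<open>A' n\<close>, so \<open>A \<inter> V\<close> is covered by these two sets. It is
    therefore meager, and \<open>V\<close> misses \<open>nonmeager_points A\<close>, hence also
    \<open>?Q\<close>.\<close>
  have "meager_in euclidean ((\<Union>n. A' n - nonmeager_points (A' n)) \<union> (V - ?Q))"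
    by (intro meager_in_Un meager_in_UN_nat meager_Diff_nonmeager_points sc V)
  then have "meager_in euclidean (A \<inter> V)"
    by (rule meager_in_subset) (use A in auto)
  then have disj: "V \<inter> nonmeager_points A = {}"
    using V(1) by (auto simp: nonmeager_points_def)
  then have "V - ?Q = V" by blast
  with V show False by simp
qed


text \<open>\<open>A\<close> agrees with the closed set \<open>?D []\<close> up to a meager set. A
  point of \<open>?D []\<close> outside \<open>M\<close> can always pass from \<open>?D l\<close> to
  some \<open>?D (l @ [n])\<close> and so traces a branch \<open>y\<close>. It lies in the closure
  of the image of every cylinder around \<open>y\<close>, and continuity of \<open>g\<close> with
  the Hausdorff property leaves only the point \<open>g y\<close>.\<close>

lemma analytic_imp_almost_open:
  assumes Hausdorff: "Hausdorff_space (euclidean :: 'a::topological_space topology)"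
    and sc: "second_countable (euclidean :: 'a topology)"
    and "analytic (A :: 'a set)"
  shows "almost_open A"
proof (cases "A = {}")
  case False
  then obtain g :: "(nat \<Rightarrow> nat) \<Rightarrow> 'a" where g: "continuous_on UNIV g" "A = range g"
    using assms(3) by (auto simp: analytic_def)
  define G where "G l = g ` {y. map y [0..<length l] = l}" for l
  let ?D = "\<lambda>l. nonmeager_points (G l)"
  have G_Nil: "G [] = A"
    by (auto simp: G_def g)
  have G_UN: "G l = (\<Union>n. G (l @ [n]))" for l
    by (auto simp: G_def)
  define M where "M = (\<Union>l. ?D l - (\<Union>n. ?D (l @ [n])))"
  have "meager_in euclidean M"
    unfolding M_def by (intro meager_in_UN meager_nonmeager_points_UN sc G_UN) auto
  have "x \<in> A" if x: "x \<in> ?D []" "x \<notin> M" for x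
  proof -
    define nxt where "nxt l = (SOME n. x \<in> ?D (l @ [n]))" for l
    have nxt: "x \<in> ?D (l @ [nxt l])" if "x \<in> ?D l" for l
    proof -
      have "\<exists>n. x \<in> ?D (l @ [n])"
        using that x(2) unfolding M_def by blast
      then show ?thesis
        unfolding nxt_def by (rule someI_ex)
    qed
    define L where "L = rec_nat [] (\<lambda>_ l. l @ [nxt l])"
    define y where "y k = nxt (L k)" for k
    have L: "L 0 = []" "\<And>k. L (Suc k) = L k @ [y k]"
      by (auto simp: L_def y_def)
    have map_y: "map y [0..<k] = L k" for k
      by (induction k) (auto simp: L)
    have x_L: "x \<in> ?D (L k)" for k
      by (induction k) (use x(1) nxt in \<open>auto simp: L y_def\<close>)
    have "x = g y"
    proof (rule ccontr)
      assume "x \<noteq> g y"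
      then have "\<exists>P Q. openin euclidean P \<and> openin euclidean Q \<and> x \<in> P \<and> g y \<in> Q \<and> disjnt P Q"
        by (intro Hausdorff[unfolded Hausdorff_space_def, rule_format]) simp
      then obtain P Q where PQ: "open P" "open Q" "x \<in> P" "g y \<in> Q" "P \<inter> Q = {}"
        unfolding open_openin[symmetric] disjnt_def by blast
      have "open (g -` Q)"
        using g(1) PQ(2) by (simp add: continuous_on_open_vimage)
      then obtain k where k: "cylinder y k \<subseteq> g -` Q"
        using cylinder_subset_open PQ(4) by (metis vimageI)
      have "length (L k) = k"
        by (metis map_y length_map length_upt diff_zero)
      have "G (L k) \<subseteq> Q"
      proof
        fix z assume "z \<in> G (L k)"
        then obtain w where w: "z = g w" "map w [0..<k] = map y [0..<k]"
          using \<open>length (L k) = k\<close> by (auto simp: G_def map_y)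
        then have "w \<in> cylinder y k" by (auto simp: cylinder_def)
        with k w(1) show "z \<in> Q" by blast
      qed
      moreover have "P \<inter> closure (G (L k)) \<noteq> {}"
        using x_L[of k] nonmeager_points_subset_closure PQ(3) by blast
      ultimately show False
        using PQ(1,5) open_Int_closure_eq_empty by blast
    qed
    then show ?thesis using g(2) by simp
  qed
  then have sub: "?D [] - A \<subseteq> M"
    by blast
  have "meager_in euclidean ((A - ?D []) \<union> M)"
    using meager_in_Un[OF meager_Diff_nonmeager_points[OF sc, of A] \<open>meager_in euclidean M\<close>]
    by (simp add: G_Nil)
  moreover have "almost_open (?D [])"
    using almost_open_Compl[OF almost_open_open, of "- ?D []"] closed_nonmeager_points[of "G []"] by auto
  ultimately show ?thesis
    using sub by (elim almost_open_cong_meager) (auto simp: G_Nil)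
qed (simp add: almost_open_open)

section \<open>Ideals with the Baire property\<close>

text \<open>A continuous involution is a homeomorphism, so nonempty open sets can be moved by
  \<open>h\<close> and back.\<close>

lemma meager_vimage_involution:
  fixes h :: "'a::topological_space \<Rightarrow> 'a"
  assumes h: "continuous_on UNIV h" "\<And>x. h (h x) = x" and "meager_in euclidean M"
  shows "meager_in euclidean (h -` M)"
proof -
  have nd: "nowhere_dense_in euclidean (h -` N)" if N: "nowhere_dense_in euclidean N" for N
  proof (rule nowhere_dense_inI)
    fix V :: "'a set" assume V: "openin euclidean V" "V \<noteq> {}"
    have op: "open (h -` W)" if "open W" for W :: "'a set"
      using h(1) that by (simp add: continuous_on_open_vimage)
    obtain x where "x \<in> V" using V by blast
    then have "h x \<in> h -` V" using h(2) by simp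
    moreover have "openin euclidean (h -` V)" using V op by simp
    ultimately obtain V' where V': "openin euclidean V'" "V' \<noteq> {}" "V' \<subseteq> h -` V" "V' \<inter> N = {}"
      using nowhere_dense_inD[OF N, of "h -` V"] by blast
    obtain y where "y \<in> V'" using V' by blast
    then have "h y \<in> h -` V'" using h(2) by simp
    moreover have "h -` V' \<subseteq> V"
      using V'(3) h(2) by force
    ultimately show "\<exists>V'. openin euclidean V' \<and> V' \<noteq> {} \<and> V' \<subseteq> V \<and> V' \<inter> h -` N = {}"
      using V' op by (intro exI[of _ "h -` V'"]) auto
  qed simp
  obtain N :: "nat \<Rightarrow> _" where N: "\<forall>n. nowhere_dense_in euclidean (N n)" "M = (\<Union>n. N n)"
    using assms(3) by (auto simp: meager_in_def)
  then show ?thesis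
    unfolding meager_in_def using nd by (intro exI[of _ "\<lambda>n. h -` N n"]) auto
qed

lemma mem_char_funs: "y \<in> char_funs I \<longleftrightarrow> {i. y i} \<in> I"
proof
  assume "{i. y i} \<in> I"
  then show "y \<in> char_funs I" unfolding char_funs_def by (rule rev_image_eqI) simp
qed (auto simp: char_funs_def)

text \<open>If \<open>I\<close> were comeager in a cylinder, then the flip of all later coordinates would produce two
  members of \<open>I\<close> whose union is cofinite.\<close>

lemma admissible_ideal_meager:
  assumes I: "admissible_ideal I" and "almost_open (char_funs I)"
  shows "meager_in euclidean (char_funs I)"
proof (rule ccontr)
  assume "\<not> meager_in euclidean (char_funs I)"
  then obtain V where V: "open V" "\<not> meager_in euclidean V" "meager_in euclidean (V - char_funs I)"
    using assms(2) by (metis almost_open_nonmeager)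
  have "V \<noteq> {}" using V(2) meager_in_empty by metis
  then obtain x where "x \<in> V" by blast
  then obtain n where n: "cylinder x n \<subseteq> V"
    using V(1) cylinder_subset_open by metis
  define h :: "(nat \<Rightarrow> bool) \<Rightarrow> nat \<Rightarrow> bool" where "h y i = (if i < n then y i else \<not> y i)" for y i
  have Not: "continuous_on UNIV Not"
    by (simp add: continuous_on_open_vimage open_discrete)
  have "continuous_on UNIV (\<lambda>y. h y i)" for i
    using continuous_on_product_coordinates[of i]
      continuous_on_compose2[OF Not continuous_on_product_coordinates[of i]]
    unfolding h_def by (cases "i < n") auto
  then have h: "continuous_on UNIV h"
    by (intro continuous_on_coordinatewise_then_product) auto
  have hh: "h (h y) = y" for y
    by (rule ext) (simp add: h_def)
  let ?M = "cylinder x n - char_funs I"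
  have M: "meager_in euclidean ?M"
    using V(3) by (rule meager_in_subset) (use n in blast)
  then have "meager_in euclidean (?M \<union> h -` ?M)"
    by (intro meager_in_Un meager_vimage_involution h hh)
  moreover have "\<not> meager_in euclidean (cylinder x n)"
    by (rule not_meager_open[OF completely_metrizable_discrete_sequences]) (auto simp: open_cylinder, auto simp: cylinder_def)
  ultimately obtain y where y: "y \<in> cylinder x n" "y \<notin> ?M" "y \<notin> h -` ?M"
    using meager_in_subset by blast
  moreover have "h y \<in> cylinder x n"
    using y(1) by (auto simp: cylinder_def h_def)
  ultimately have "{i. y i} \<in> I" "{i. h y i} \<in> I"
    by (auto simp: mem_char_funs)
  moreover have "{..<n} \<in> I"
    using I by (simp add: admissible_ideal_def)
  ultimately have "{i. y i} \<union> {i. h y i} \<union> {..<n} \<in> I"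
    using I by (simp add: admissible_ideal_def)
  moreover have "{i. y i} \<union> {i. h y i} \<union> {..<n} = UNIV"
    by (auto simp: h_def)
  ultimately show False
    using I by (simp add: admissible_ideal_def)
qed

text \<open>Only finitely many patterns precede coordinate \<open>m\<close>. They are treated one
  after another, each time lengthening the word on the block until that pattern followed by the word
  forces a point out of \<open>N\<close>; the final word works after every pattern.\<close>

lemma nowhere_dense_block:
  assumes N: "nowhere_dense_in euclidean (N :: (nat \<Rightarrow> bool) set)"
  shows "\<exists>m'>m. \<exists>t. \<forall>x. (\<forall>i\<in>{m..<m'}. x i = t i) \<longrightarrow> x \<notin> N"
proof -
  have step: "\<exists>m'>m. \<exists>t. \<forall>p\<in>P. \<forall>x. (\<forall>i<m. x i = p i) \<longrightarrow> (\<forall>i\<in>{m..<m'}. x i = t i) \<longrightarrow> x \<notin> N"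
    if "finite P" for P :: "(nat \<Rightarrow> bool) set"
    using that
  proof (induction P rule: finite_induct)
    case empty
    show ?case by (intro exI[of _ "Suc m"]) auto
  next
    case (insert p P)
    then obtain m' t where m': "m < m'"
      and t: "\<And>q x. q \<in> P \<Longrightarrow> (\<forall>i<m. x i = q i) \<Longrightarrow> (\<forall>i\<in>{m..<m'}. x i = t i) \<Longrightarrow> x \<notin> N"
      by metis
    \<comment> \<open>The word \<open>t\<close> found so far is kept as a prefix, so the patterns
      already treated remain treated.\<close>
    define z where "z i = (if i < m then p i else t i)" for i
    have "z \<in> cylinder z m'" by (simp add: cylinder_def)
    then obtain V where V: "open V" "V \<noteq> {}" "V \<subseteq> cylinder z m'" "V \<inter> N = {}"
      using nowhere_dense_inD[OF N, of "cylinder z m'"] open_cylinder by auto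
    then obtain y where y: "y \<in> V" by blast
    then obtain l where l: "cylinder y l \<subseteq> V"
      using V(1) cylinder_subset_open by metis
    have yz: "y i = z i" if "i < m'" for i
      using y V(3) that by (auto simp: cylinder_def)
    show ?case
    proof (intro exI[of _ "max m' l"] exI[of _ y] conjI ballI allI impI)
      fix q x assume q: "q \<in> insert p P" and x: "\<forall>i<m. x i = q i" "\<forall>i\<in>{m..<max m' l}. x i = y i"
      show "x \<notin> N"
      proof (cases "q \<in> P")
        case True
        have "\<forall>i\<in>{m..<m'}. x i = t i"
          using x(2) yz by (auto simp: z_def)
        then show ?thesis using t[of q x] True x(1) by simp
      next
        case False
        then have q: "q = p" using q by simp
        have "x i = y i" if "i < l" for i
          using x yz[of i] m' that by (cases "i < m") (auto simp: z_def q)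
        then have "x \<in> cylinder y l" by (simp add: cylinder_def)
        with l V(4) show ?thesis by blast
      qed
    qed (use m' in auto)
  qed
  let ?P = "(\<lambda>S i. i \<in> S) ` Pow {..<m}"
  have "finite ?P" by simp
  from step[OF this] obtain m' t where m': "m < m'"
    and t: "\<And>p x. p \<in> ?P \<Longrightarrow> (\<forall>i<m. x i = p i) \<Longrightarrow> (\<forall>i\<in>{m..<m'}. x i = t i) \<Longrightarrow> x \<notin> N"
    by metis
  have "x \<notin> N" if "\<forall>i\<in>{m..<m'}. x i = t i" for x
  proof -
    have "(\<lambda>i. i \<in> {i. i < m \<and> x i}) \<in> ?P" by (rule imageI) auto
    then show ?thesis using t[of "\<lambda>i. i \<in> {i. i < m \<and> x i}" x] that by simp
  qed
  with m' show ?thesis by blast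
qed

text \<open>The interval characterisation of meager ideals (Talagrand, Jalali-Naini).\<close>

lemma meager_ideal_intervals:
  assumes I: "admissible_ideal I" and meager: "meager_in euclidean (char_funs I)"
  obtains m :: "nat \<Rightarrow> nat"
  where "strict_mono m" "\<And>A. A \<in> I \<Longrightarrow> \<exists>K. \<forall>k\<ge>K. \<not> {m k..<m (Suc k)} \<subseteq> A"
proof -
  obtain N :: "nat \<Rightarrow> (nat \<Rightarrow> bool) set"
    where N: "\<And>n. nowhere_dense_in euclidean (N n)" "char_funs I = (\<Union>n. N n)"
    using meager by (auto simp: meager_in_def)
  \<comment> \<open>The word on the \<open>k\<close>-th block avoids \<open>N 0\<close>, ...,
    \<open>N k\<close> at once, so each single \<open>N j\<close> is avoided by all blocks from the
    \<open>j\<close>-th on.\<close>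
  have "nowhere_dense_in euclidean (\<Union>j\<le>k. N j)" for k
    by (induction k) (simp_all add: N atMost_Suc nowhere_dense_in_Un)
  then have "\<forall>k m. \<exists>m'>m. \<exists>t. \<forall>x. (\<forall>i\<in>{m..<m'}. x i = t i) \<longrightarrow> x \<notin> (\<Union>j\<le>k. N j)"
    by (intro allI nowhere_dense_block)
  then obtain e u where e: "\<And>k m. m < e k m"
    and u: "\<And>k m x. (\<forall>i\<in>{m..<e k m}. x i = u k m i) \<Longrightarrow> x \<notin> (\<Union>j\<le>k. N j)"
    by metis
  define m where "m = rec_nat 0 e"
  have m_Suc: "m (Suc k) = e k (m k)" for k
    by (simp add: m_def)
  have mono: "strict_mono m"
    by (simp add: strict_mono_Suc_iff m_Suc e)
  have unique: "k = l" if "i \<in> {m k..<m (Suc k)}" "i \<in> {m l..<m (Suc l)}" for i k l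
  proof (rule ccontr)
    assume "k \<noteq> l"
    then have "Suc k \<le> l \<or> Suc l \<le> k" by auto
    then have "m (Suc k) \<le> m l \<or> m (Suc l) \<le> m k"
      using mono by (auto simp: strict_mono_less_eq)
    with that show False by auto
  qed
  have "\<exists>K. \<forall>k\<ge>K. \<not> {m k..<m (Suc k)} \<subseteq> A" if "A \<in> I" for A
  proof -
    \<comment> \<open>\<open>x\<close> copies the avoiding word on every block contained in
      \<open>A\<close> and is false elsewhere, so its support lies in \<open>A\<close> and belongs
      to \<open>I\<close>. Thus \<open>x\<close> is in some \<open>N K\<close>, and no block from
      the \<open>K\<close>-th on can be contained in \<open>A\<close>.\<close>
    define x where "x i \<longleftrightarrow> (\<exists>k. i \<in> {m k..<m (Suc k)} \<and> {m k..<m (Suc k)} \<subseteq> A \<and> u k (m k) i)" for i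
    have "{i. x i} \<subseteq> A" by (auto simp: x_def)
    then have "{i. x i} \<in> I"
      using I that by (auto simp: admissible_ideal_def)
    then obtain K where K: "x \<in> N K"
      using N(2) by (auto simp flip: mem_char_funs)
    have "\<not> {m k..<m (Suc k)} \<subseteq> A" if "k \<ge> K" for k
    proof
      assume "{m k..<m (Suc k)} \<subseteq> A"
      then have "\<forall>i\<in>{m k..<e k (m k)}. x i = u k (m k) i"
        using unique unfolding x_def m_Suc[symmetric] by blast
      then have "x \<notin> (\<Union>j\<le>k. N j)" using u[where k = k and m = "m k" and x = x] by simp
      with K that show False by blast
    qed
    then show ?thesis by blast
  qed
  with mono show thesis by (rule that)
qed


section \<open>Partitions into meager sets\<close>

text \<open>Transfinite recursion along a well-order of the index type whose initial segments are
  all smaller than the type. At stage \<open>i\<close> the points chosen earlier are too few to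
  exhaust \<open>K i\<close>, so two fresh points remain: the first is put into \<open>S\<close>,
  the second is kept out for good.\<close>

lemma bernstein_set:
  includes cardinal_syntax
  fixes K :: "'i \<Rightarrow> 'c set"
  assumes inf: "infinite (UNIV :: 'i set)"
    and K: "\<And>i. i \<in> A \<Longrightarrow> |UNIV :: 'i set| \<le>o |K i|"
  obtains S where "\<And>i. i \<in> A \<Longrightarrow> K i \<inter> S \<noteq> {}" "\<And>i. i \<in> A \<Longrightarrow> \<not> K i \<subseteq> S"
proof -
  let ?r = "|UNIV :: 'i set|"
  let ?R = "?r - Id"
  \<comment> \<open>For \<open>i\<close> outside \<open>A\<close> nothing is demanded and the chosen
    pair is arbitrary; later stages avoid these pairs as well, which does not affect the cardinality
    count.\<close>
  define P :: "('i \<Rightarrow> 'c \<times> 'c) \<Rightarrow> 'i \<Rightarrow> 'c \<times> 'c \<Rightarrow> bool" where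
    "P f i p \<longleftrightarrow> (i \<in> A \<longrightarrow> fst p \<in> K i \<and> snd p \<in> K i \<and> fst p \<noteq> snd p \<and>
       (\<forall>j. (j, i) \<in> ?R \<longrightarrow> {fst p, snd p} \<inter> {fst (f j), snd (f j)} = {}))" for f i p
  have wo: "well_order_on UNIV ?r" by (rule card_of_well_order_on)
  have "\<exists>p. P f i p" for f i
  proof (cases "i \<in> A")
    case True
    let ?Y = "{j. (j, i) \<in> ?R}"
    have less: "|?Y| <o ?r"
      using card_of_underS[OF card_of_Card_order, of i "UNIV :: 'i set"]
      by (simp add: underS_def Field_card_of conj_commute)
    define U where "U = (fst \<circ> f) ` ?Y \<union> (snd \<circ> f) ` ?Y"
    have U: "|U| <o ?r"
      unfolding U_def
      by (intro card_of_Un_ordLess_infinite inf ordLeq_ordLess_trans[OF card_of_image less])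
    have fin: "|{a}| <o ?r" for a :: 'c
      using inf by (intro finite_ordLess_infinite card_of_Well_order) (simp_all add: Field_card_of)
    have ne: "\<exists>b. b \<in> K i \<and> b \<notin> U'" if "|U'| <o ?r" for U'
    proof (rule ccontr)
      assume "\<not> ?thesis"
      then have "|K i| \<le>o |U'|" by (intro card_of_mono1) blast
      then have "|K i| <o ?r" using that by (rule ordLeq_ordLess_trans)
      then show False using K[OF True] not_ordLess_ordLeq by blast
    qed
    obtain a where a: "a \<in> K i" "a \<notin> U" using ne[OF U] by blast
    obtain b where b: "b \<in> K i" "b \<notin> U \<union> {a}"
      using ne[OF card_of_Un_ordLess_infinite[OF inf U fin]] by blast
    have "P f i (a, b)"
      using a b by (auto simp: P_def U_def image_iff)
    then show ?thesis ..
  qed (simp add: P_def)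
  moreover have "wf ?R" using wo by (simp add: well_order_on_def)
  moreover have "P f i p = P g i p" if "\<And>j. (j, i) \<in> ?R \<Longrightarrow> f j = g j" for f g i p
    unfolding P_def using that by simp
  ultimately have "\<exists>f. \<forall>i. P f i (f i)"
    by (intro dependent_wf_choice) blast+
  then obtain f where f: "\<And>i. P f i (f i)" by blast
  let ?S = "(fst \<circ> f) ` A"
  show thesis
  proof (rule that[of ?S])
    fix i assume i: "i \<in> A"
    show "K i \<inter> ?S \<noteq> {}"
      using f[of i] i by (auto simp: P_def)
    have "snd (f i) \<noteq> fst (f j)" if "j \<in> A" for j
    proof (cases "i = j")
      case True
      then show ?thesis using f[of i] i unfolding P_def by metis
    next
      case False
      then have "(i, j) \<in> ?R \<or> (j, i) \<in> ?R"
        using wo by (auto simp: well_order_on_def linear_order_on_def total_on_def)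
      then show ?thesis
        using f[of i] f[of j] i that unfolding P_def by blast
    qed
    then show "\<not> K i \<subseteq> ?S"
      using f[of i] i by (auto simp: P_def)
  qed
qed

text \<open>A Cantor scheme: each ball contains two points with different values of
  \<open>g\<close>, hence two small closed balls with disjoint images. Completeness puts a point on
  every branch of the binary tree, and \<open>g\<close> separates points of different
  branches.\<close>

lemma card_image_no_constant_open:
  includes cardinal_syntax
  assumes cm: "completely_metrizable_space T" and ne: "topspace T \<noteq> {}"
    and g: "continuous_map T T' g" and T': "Hausdorff_space T'"
    and nonconst: "\<And>U. openin T U \<Longrightarrow> U \<noteq> {} \<Longrightarrow> \<exists>x\<in>U. \<exists>y\<in>U. g x \<noteq> g y"
  shows "|UNIV :: (nat \<Rightarrow> bool) set| \<le>o |g ` topspace T|"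
proof -
  obtain M d where "Metric_space M d" and complete: "Metric_space.mcomplete M d"
    and T: "T = Metric_space.mtopology M d"
    using cm by (auto simp: completely_metrizable_space_def)
  interpret Metric_space M d by fact
  \<comment> \<open>The bound \<open>e\<close> will be \<open>1/(k+1)\<close> at depth
    \<open>k\<close>; it makes the radii tend to zero, as the nested-ball form of completeness
    demands.\<close>
  define Split where "Split x r e y0 y1 s \<longleftrightarrow> y0 \<in> M \<and> y1 \<in> M \<and> 0 < s \<and> s \<le> e \<and> mcball y0 s \<subseteq> mball x r \<and>
    mcball y1 s \<subseteq> mball x r \<and> g ` mcball y0 s \<inter> g ` mcball y1 s = {}" for x r e y0 y1 s
  have "\<exists>y0 y1 s. Split x r e y0 y1 s" if x: "x \<in> M" and "r > 0" and e: "e > 0" for x r e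
  proof -
    have "openin T (mball x r)" "mball x r \<noteq> {}"
      using that by (auto simp: T)
    then obtain y0 y1 where y: "y0 \<in> mball x r" "y1 \<in> mball x r" "g y0 \<noteq> g y1"
      using nonconst by metis
    then have yM: "y0 \<in> M" "y1 \<in> M" by auto
    then have "g y0 \<in> topspace T'" "g y1 \<in> topspace T'"
      using g continuous_map_image_subset_topspace T by fastforce+
    then obtain P Q where PQ: "openin T' P" "openin T' Q" "g y0 \<in> P" "g y1 \<in> Q" "disjnt P Q"
      using T' y(3) unfolding Hausdorff_space_def by metis
    have nbhd: "\<exists>s>0. mcball z s \<subseteq> mball x r \<and> g ` mcball z s \<subseteq> W"
      if W: "openin T' W" "g z \<in> W" and z: "z \<in> mball x r" for z W
    proof -
      have "openin T {u \<in> topspace T. g u \<in> W}"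
        using g W(1) by (rule openin_continuous_map_preimage)
      then have "openin mtopology (mball x r \<inter> {u \<in> M. g u \<in> W})"
        by (auto simp: T)
      moreover have "z \<in> mball x r \<inter> {u \<in> M. g u \<in> W}"
        using z W(2) by auto
      ultimately obtain s where s: "s > 0" "mball z s \<subseteq> mball x r \<inter> {u \<in> M. g u \<in> W}"
        unfolding openin_mtopology by blast
      have "mcball z (s/2) \<subseteq> mball z s"
        using s(1) by (auto simp: in_mcball in_mball)
      with s show ?thesis by (intro exI[of _ "s/2"]) auto
    qed
    obtain s0 where s0: "s0 > 0" "mcball y0 s0 \<subseteq> mball x r" "g ` mcball y0 s0 \<subseteq> P"
      using nbhd PQ y by metis
    obtain s1 where s1: "s1 > 0" "mcball y1 s1 \<subseteq> mball x r" "g ` mcball y1 s1 \<subseteq> Q"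
      using nbhd PQ y by metis
    define s where "s = min e (min s0 s1)"
    have "mcball y0 s \<subseteq> mcball y0 s0" "mcball y1 s \<subseteq> mcball y1 s1"
      by (auto simp: s_def in_mcball)
    then have "Split x r e y0 y1 s"
      using yM s0 s1 e PQ(5) unfolding s_def disjnt_def Split_def by (intro conjI) (simp, simp, simp, simp, blast+)
    then show ?thesis by blast
  qed
  then have "\<forall>x r e. \<exists>y0 y1 s. x \<in> M \<longrightarrow> r > 0 \<longrightarrow> e > 0 \<longrightarrow> Split x r e y0 y1 s"
    by blast
  then obtain y0 y1 s where Split: "\<And>x r e. x \<in> M \<Longrightarrow> r > 0 \<Longrightarrow> e > 0 \<Longrightarrow>
      Split x r e (y0 x r e) (y1 x r e) (s x r e)"
    by metis
  obtain x0 where x0: "x0 \<in> M" using ne by (auto simp: T)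
  define step where "step b k p = (let e = inverse (real (Suc k)) in
    ((if b then y1 (fst p) (snd p) e else y0 (fst p) (snd p) e), s (fst p) (snd p) e))" for b k p
  define B where "B = rec_list (x0, 1) (\<lambda>b l p. step b (length l) p)"
  have B_simps: "B [] = (x0, 1)" "B (b # l) = step b (length l) (B l)" for b l
    by (simp_all add: B_def)
  let ?C = "\<lambda>l. mcball (fst (B l)) (snd (B l))"
  have B_M: "fst (B l) \<in> M \<and> snd (B l) > 0" for l
  proof (induction l)
    case (Cons b l)
    then show ?case
      using Split[unfolded Split_def, of "fst (B l)" "snd (B l)" "inverse (real (Suc (length l)))"]
      by (simp add: B_simps step_def Let_def)
  qed (simp add: B_simps x0)
  have B_Cons: "?C (b # l) \<subseteq> ?C l" "snd (B (b # l)) \<le> inverse (real (Suc (length l)))"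
    "g ` ?C (True # l) \<inter> g ` ?C (False # l) = {}" for b l
  proof -
    note * = Split[unfolded Split_def, of "fst (B l)" "snd (B l)" "inverse (real (Suc (length l)))"]
    have "mball (fst (B l)) (snd (B l)) \<subseteq> ?C l" by auto
    then show "?C (b # l) \<subseteq> ?C l"
      using * B_M[of l] by (cases b) (simp_all add: B_simps step_def Let_def, blast+)
    show "snd (B (b # l)) \<le> inverse (real (Suc (length l)))"
      using * B_M[of l] by (simp add: B_simps step_def Let_def)
    show "g ` ?C (True # l) \<inter> g ` ?C (False # l) = {}"
      using * B_M[of l] by (simp add: B_simps step_def Let_def Int_commute)
  qed
  \<comment> \<open>New bits are put in front, so \<open>path \<beta> n\<close> is the reversed list
    of the first \<open>n\<close> bits and each \<open>Cons\<close> descends to a sub-ball.\<close>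
  define path where "path \<beta> = rec_nat [] (\<lambda>n l. \<beta> n # l)" for \<beta> :: "nat \<Rightarrow> bool"
  have path: "path \<beta> 0 = []" "path \<beta> (Suc n) = \<beta> n # path \<beta> n" for \<beta> n
    by (simp_all add: path_def)
  have len: "length (path \<beta> n) = n" for \<beta> n
    by (induction n) (simp_all add: path)
  have "\<Inter> (range (\<lambda>n. ?C (path \<beta> n))) \<noteq> {}" for \<beta>
  proof -
    have small: "\<exists>n a. ?C (path \<beta> n) \<subseteq> mcball a \<epsilon>" if "\<epsilon> > 0" for \<epsilon>
    proof -
      obtain n where n: "inverse (real (Suc n)) < \<epsilon>"
        using \<open>\<epsilon> > 0\<close> reals_Archimedean by blast
      then have "snd (B (path \<beta> (Suc n))) \<le> \<epsilon>"
        using B_Cons(2)[of "\<beta> n" "path \<beta> n"] by (simp add: path len)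
      then have "?C (path \<beta> (Suc n)) \<subseteq> mcball (fst (B (path \<beta> (Suc n)))) \<epsilon>"
        by (auto simp: in_mcball)
      then show ?thesis by blast
    qed
    have dec: "decseq (\<lambda>n. ?C (path \<beta> n))"
      unfolding decseq_Suc_iff path(2) using B_Cons(1) by blast
    have nonempty: "?C (path \<beta> n) \<noteq> {}" for n
      using B_M[of "path \<beta> n"] by (simp add: mcball_eq_empty)
    have "(\<forall>n. closedin mtopology (?C (path \<beta> n))) \<and> (\<forall>n. ?C (path \<beta> n) \<noteq> {}) \<and>
      decseq (\<lambda>n. ?C (path \<beta> n)) \<and> (\<forall>\<epsilon>>0. \<exists>n a. ?C (path \<beta> n) \<subseteq> mcball a \<epsilon>)"
      by (intro conjI allI impI closedin_mcball nonempty dec small)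
    then show ?thesis
      by (rule complete[unfolded mcomplete_nest, THEN spec, THEN mp])
  qed
  then have "\<forall>\<beta>. \<exists>z. \<forall>n. z \<in> ?C (path \<beta> n)"
    unfolding ex_in_conv[symmetric] INT_iff by blast
  from choice[OF this] obtain z where "\<forall>\<beta> n. z \<beta> \<in> ?C (path \<beta> n)" ..
  then have z: "z \<beta> \<in> ?C (path \<beta> n)" for \<beta> n by blast
  have inj: "inj (g \<circ> z)"
  proof (rule injI, rule ccontr)
    fix \<beta> \<gamma> assume eq: "(g \<circ> z) \<beta> = (g \<circ> z) \<gamma>" and "\<beta> \<noteq> \<gamma>"
    then have ex: "\<exists>n. \<beta> n \<noteq> \<gamma> n" by auto
    define n where "n = (LEAST n. \<beta> n \<noteq> \<gamma> n)"
    have n: "\<beta> n \<noteq> \<gamma> n" unfolding n_def using ex by (rule LeastI_ex)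
    have "\<beta> i = \<gamma> i" if "i < n" for i
      using not_less_Least that unfolding n_def by blast
    then have "path \<beta> k = path \<gamma> k" if "k \<le> n" for k
      using that by (induction k) (auto simp: path)
    then have eq_n: "path \<gamma> n = path \<beta> n" by simp
    have z_\<beta>: "z \<beta> \<in> ?C (\<beta> n # path \<beta> n)"
      using z[of \<beta> "Suc n"] unfolding path(2) .
    have z_\<gamma>: "z \<gamma> \<in> ?C (\<gamma> n # path \<beta> n)"
      using z[of \<gamma> "Suc n"] unfolding path(2) eq_n .
    have disj: "g u \<noteq> g v" if "u \<in> ?C (True # path \<beta> n)" "v \<in> ?C (False # path \<beta> n)" for u v
      using B_Cons(3)[of "path \<beta> n"] that by (metis disjoint_iff imageI)
    show False
    proof (cases "\<beta> n")
      case True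
      then have bits: "\<beta> n = True" "\<gamma> n = False" using n by simp_all
      have "g (z \<beta>) \<noteq> g (z \<gamma>)"
        using z_\<beta> z_\<gamma> unfolding bits by (rule disj)
      with eq show False by simp
    next
      case False
      then have bits: "\<beta> n = False" "\<gamma> n = True" using n by simp_all
      have "g (z \<gamma>) \<noteq> g (z \<beta>)"
        using z_\<gamma> z_\<beta> unfolding bits by (rule disj)
      with eq show False by simp
    qed
  qed
  have "z \<beta> \<in> M" for \<beta>
    using z[of \<beta> 0] by simp
  then have "range (g \<circ> z) \<subseteq> g ` topspace T"
    by (auto simp: T)
  with inj show ?thesis
    using card_of_ordLeq by blast
qed

section \<open>Maps with meager fibres on a Polish space\<close>

lemma countable_base_seq:
  obtains B :: "nat \<Rightarrow> 'a::second_countable_topology set"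
  where "\<And>n. open (B n)" "\<And>U x. open U \<Longrightarrow> x \<in> U \<Longrightarrow> \<exists>n. x \<in> B n \<and> B n \<subseteq> U"
proof -
  obtain \<B> :: "'a set set" where \<B>: "countable \<B>" "topological_basis \<B>"
    using ex_countable_basis by blast
  have "\<B> \<noteq> {}"
    using topological_basisE[OF \<B>(2) open_UNIV UNIV_I] by blast
  then have range: "range (from_nat_into \<B>) = \<B>"
    using \<B>(1) by (rule range_from_nat_into)
  show thesis
  proof (rule that[of "from_nat_into \<B>"])
    show "open (from_nat_into \<B> n)" for n
      using range topological_basis_open[OF \<B>(2)] by blast
    show "\<exists>n. x \<in> from_nat_into \<B> n \<and> from_nat_into \<B> n \<subseteq> U" if "open U" "x \<in> U" for U x
      using topological_basisE[OF \<B>(2) that] range by (metis imageE)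
  qed
qed

text \<open>On a comeager set \<open>h\<close> is continuous, and each nonmeager set \<open>P \<subseteq> W\<close> with the Baire property
  contains a \<open>G\<^sub>\<delta>\<close> set \<open>H\<close> on which no open piece lies in one fibre, so that \<open>h ` H\<close> has size continuum.
  There are only continuum many \<open>G\<^sub>\<delta>\<close> sets, hence some \<open>S\<close> splits all these images, and one of
  \<open>{x \<in> W. h x \<in> S}\<close>, \<open>{x \<in> W. h x \<notin> S}\<close> lacks the Baire property.\<close>

lemma meager_domain_of_meager_fibres_self:
  includes cardinal_syntax
  fixes h :: "'a::polish_space \<Rightarrow> 'a"
  assumes ao: "\<And>S. almost_open {x \<in> W. h x \<in> S}"
    and fibres: "\<And>r. meager_in euclidean {x \<in> W. h x = r}"
  shows "meager_in euclidean W"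
proof (rule ccontr)
  assume W: "\<not> meager_in euclidean W"
  obtain B :: "nat \<Rightarrow> 'a set" where B: "\<And>n. open (B n)"
    "\<And>U x. open U \<Longrightarrow> x \<in> U \<Longrightarrow> \<exists>n. x \<in> B n \<and> B n \<subseteq> U"
    by (rule countable_base_seq) blast
  have "\<forall>n. \<exists>U. open U \<and> meager_in euclidean (({x \<in> W. h x \<in> B n} - U) \<union> (U - {x \<in> W. h x \<in> B n}))"
    using ao unfolding almost_open_def by blast
  from choice[OF this] obtain U where U: "\<And>n. open (U n)"
    "\<And>n. meager_in euclidean (({x \<in> W. h x \<in> B n} - U n) \<union> (U n - {x \<in> W. h x \<in> B n}))"
    by blast
  define M where "M = (\<Union>n. ({x \<in> W. h x \<in> B n} - U n) \<union> (U n - {x \<in> W. h x \<in> B n}))"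
  have M: "meager_in euclidean M"
    unfolding M_def using U(2) by (rule meager_in_UN_nat)
  have cont: "continuous_on H h" if H: "H \<subseteq> W - M" for H
    unfolding continuous_on_topological
  proof (intro ballI allI impI)
    fix x V assume x: "x \<in> H" and V: "open V" "h x \<in> V"
    obtain n where n: "h x \<in> B n" "B n \<subseteq> V" using B(2)[OF V] by blast
    have "\<forall>y\<in>H. y \<in> U n \<longleftrightarrow> h y \<in> B n"
      using H unfolding M_def by blast
    then show "\<exists>A. open A \<and> x \<in> A \<and> (\<forall>y\<in>H. y \<in> A \<longrightarrow> h y \<in> V)"
      using x n U(1) by (intro exI[of _ "U n"]) auto
  qed
  \<comment> \<open>A set \<open>i\<close> of pairs codes a G-delta set: its \<open>n\<close>-th row
    lists the basic sets that make up the \<open>n\<close>-th open set. The type of codes has size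
    continuum and serves as the index type of \<open>bernstein_set\<close>.\<close>
  define Gd where "Gd i = (\<Inter>n. \<Union>m\<in>{m. (n, m) \<in> i}. B m)" for i :: "(nat \<times> nat) set"
  define A where "A = {i. Gd i \<subseteq> W - M \<and>
    (\<exists>V. open V \<and> V \<noteq> {} \<and> Gd i \<subseteq> V \<and> meager_in euclidean (V - Gd i))}"
  have nonmeager: "\<not> meager_in euclidean V" if "open V" "V \<noteq> {}" for V :: "'a set"
    using not_meager_open[OF completely_metrizable_space_euclidean] that by simp
  have large: "|UNIV :: (nat \<times> nat) set set| \<le>o |h ` Gd i|" if "i \<in> A" for i
  proof -
    let ?H = "Gd i"
    obtain V where H: "?H \<subseteq> W - M" and V: "open V" "V \<noteq> {}" "?H \<subseteq> V" "meager_in euclidean (V - ?H)"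
      using \<open>i \<in> A\<close> by (auto simp: A_def)
    have "(countable intersection_of openin euclidean) ?H"
      unfolding intersection_of_def Gd_def using B(1)
      by (intro exI[of _ "range (\<lambda>n. \<Union>m\<in>{m. (n, m) \<in> i}. B m)"]) auto
    then have cm: "completely_metrizable_space (top_of_set ?H)"
      by (rule completely_metrizable_space_gdelta_in_alt[OF completely_metrizable_space_euclidean])
    have "?H \<noteq> {}"
      using V(4) nonmeager[OF V(1,2)] by auto
    moreover have "\<exists>x\<in>O'. \<exists>y\<in>O'. h x \<noteq> h y" if O': "openin (top_of_set ?H) O'" "O' \<noteq> {}" for O'
    proof (rule ccontr)
      assume const: "\<not> ?thesis"
      obtain O'' where O'': "open O''" "O' = ?H \<inter> O''"
        using O'(1) by (auto simp: openin_open)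
      obtain x where "x \<in> O'" using O'(2) by blast
      then have "V \<inter> O'' \<subseteq> (V - ?H) \<union> {y \<in> W. h y = h x}"
        using const O'' H by blast
      then have "meager_in euclidean (V \<inter> O'')"
        by (rule meager_in_subset[OF meager_in_Un[OF V(4) fibres]])
      moreover have "V \<inter> O'' \<noteq> {}"
        using \<open>x \<in> O'\<close> O'' V(3) by blast
      ultimately show False
        using nonmeager V(1) O''(1) by blast
    qed
    ultimately have "|UNIV :: (nat \<Rightarrow> bool) set| \<le>o |h ` topspace (top_of_set ?H)|"
      using cont[OF H] by (intro card_image_no_constant_open[where T' = euclidean] cm) auto
    then have "|UNIV :: (nat \<Rightarrow> bool) set| \<le>o |h ` ?H|"
      by simp
    moreover have "inj (\<lambda>(i :: (nat \<times> nat) set) n. prod_decode n \<in> i)"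
    proof (rule injI)
      fix i j :: "(nat \<times> nat) set"
      assume eq: "(\<lambda>n. prod_decode n \<in> i) = (\<lambda>n. prod_decode n \<in> j)"
      have "p \<in> i \<longleftrightarrow> p \<in> j" for p
        using fun_cong[OF eq, of "prod_encode p"] by simp
      then show "i = j" by blast
    qed
    then have "|UNIV :: (nat \<times> nat) set set| \<le>o |UNIV :: (nat \<Rightarrow> bool) set|"
      using card_of_ordLeq by blast
    ultimately show ?thesis
      using ordLeq_transitive by blast
  qed
  have contains: "\<exists>i\<in>A. Gd i \<subseteq> P"
    if P: "almost_open P" "\<not> meager_in euclidean P" "P \<subseteq> W" for P
  proof -
    obtain V where V: "open V" "\<not> meager_in euclidean V" "meager_in euclidean (V - P)"
      using P(1,2) by (rule almost_open_nonmeager)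
    have "meager_in euclidean ((V - P) \<union> M)"
      using V(3) M by (rule meager_in_Un)
    then obtain N :: "nat \<Rightarrow> 'a set" where N: "\<And>n. closedin euclidean (N n)"
      "\<And>n. nowhere_dense_in euclidean (N n)" "(V - P) \<union> M \<subseteq> (\<Union>n. N n)"
      by (rule meager_in_fsigma_hull) blast
    define i where "i = {(n, m). B m \<subseteq> V - N n}"
    have "open (V - N n)" for n
      using V(1) N(1) by (simp add: open_Diff)
    then have "(\<Union>m\<in>{m. (n, m) \<in> i}. B m) = V - N n" for n
      using B(2)[of "V - N n"] by (fastforce simp: i_def)
    then have Gd: "Gd i = V - (\<Union>n. N n)"
      by (auto simp: Gd_def)
    have "meager_in euclidean (\<Union>n. N n)"
      using N(2) by (intro meager_in_UN_nat nowhere_dense_imp_meager)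
    then have "meager_in euclidean (V - Gd i)"
      by (rule meager_in_subset) (auto simp: Gd)
    moreover have "Gd i \<subseteq> P - M"
      using N(3) by (auto simp: Gd)
    moreover have "V \<noteq> {}"
      using V(2) meager_in_empty by metis
    ultimately have "i \<in> A"
      using V(1) P(3) Gd unfolding A_def by blast
    with \<open>Gd i \<subseteq> P - M\<close> show ?thesis by blast
  qed
  have "infinite (UNIV :: (nat \<times> nat) set set)"
    by (simp add: Finite_Set.finite_set finite_prod)
  then obtain S where S: "\<And>i. i \<in> A \<Longrightarrow> h ` Gd i \<inter> S \<noteq> {}" "\<And>i. i \<in> A \<Longrightarrow> \<not> h ` Gd i \<subseteq> S"
    using bernstein_set[of A "\<lambda>i. h ` Gd i"] large by metis
  \<comment> \<open>Were this set nonmeager, it would contain \<open>Gd i\<close> for some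
    \<open>i \<in> A\<close>, and \<open>h\<close> would map that \<open>Gd i\<close> into
    \<open>S\<close>, against the choice of \<open>S\<close>. The complement of \<open>S\<close> is
    symmetric.\<close>
  have "meager_in euclidean {x \<in> W. h x \<in> S}"
    using contains[OF ao, of S] S(2) by blast
  moreover have "meager_in euclidean {x \<in> W. h x \<in> - S}"
    using contains[OF ao, of "- S"] S(1) by blast
  ultimately have "meager_in euclidean ({x \<in> W. h x \<in> S} \<union> {x \<in> W. h x \<in> - S})"
    by (rule meager_in_Un)
  then have "meager_in euclidean W"
    by (rule meager_in_subset) auto
  with W show False ..
qed

text \<open>The type of values carries no topology. Naming every fibre by one of its own points
  gives a map of the Polish space into itself with the same fibres on \<open>W\<close>.\<close>

lemma meager_domain_of_meager_fibres:
  fixes g :: "'a::polish_space \<Rightarrow> 'c"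
  assumes ao: "\<And>S. almost_open {x \<in> W. g x \<in> S}"
    and fibres: "\<And>r. meager_in euclidean {x \<in> W. g x = r}"
  shows "meager_in euclidean W"
proof -
  define rep where "rep r = (SOME x. x \<in> W \<and> g x = r)" for r
  have rep: "g (rep (g x)) = g x" if "x \<in> W" for x
    unfolding rep_def using someI[of "\<lambda>y. y \<in> W \<and> g y = g x" x] that by simp
  show ?thesis
  proof (rule meager_domain_of_meager_fibres_self[where h = "\<lambda>x. rep (g x)"])
    show "almost_open {x \<in> W. rep (g x) \<in> S}" for S
      using ao[of "{r. rep r \<in> S}"] by simp
    show "meager_in euclidean {x \<in> W. rep (g x) = r}" for r
    proof (rule meager_in_subset[OF fibres[of "g r"]])
      show "{x \<in> W. rep (g x) = r} \<subseteq> {x \<in> W. g x = g r}"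
        using rep by auto
    qed
  qed
qed


section \<open>Essentially separable range of functions with the Baire property\<close>

lemma almost_open_vimage:
  "has_baire_property f \<Longrightarrow> open V \<Longrightarrow> almost_open (f -` V)"
  by (simp add: has_baire_property_def baire_sets_imp_almost_open)

text \<open>The countable chain condition modulo meager sets: each \<open>A z\<close> is comeager in
  some nonempty basic open set, and two disjoint sets cannot share one, as it would be
  meager.\<close>

lemma countable_disjoint_nonmeager:
  fixes A :: "'z \<Rightarrow> 'a::polish_space set"
  assumes ao: "\<And>z. z \<in> Z \<Longrightarrow> almost_open (A z)"
    and nonmeager: "\<And>z. z \<in> Z \<Longrightarrow> \<not> meager_in euclidean (A z)"
    and disj: "\<And>y z. y \<in> Z \<Longrightarrow> z \<in> Z \<Longrightarrow> y \<noteq> z \<Longrightarrow> A y \<inter> A z = {}"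
  shows "countable Z"
proof -
  obtain B :: "nat \<Rightarrow> 'a set" where B: "\<And>n. open (B n)"
    "\<And>U x. open U \<Longrightarrow> x \<in> U \<Longrightarrow> \<exists>n. x \<in> B n \<and> B n \<subseteq> U"
    by (rule countable_base_seq) blast
  have "\<exists>n. B n \<noteq> {} \<and> meager_in euclidean (B n - A z)" if z: "z \<in> Z" for z
  proof -
    obtain V where V: "open V" "\<not> meager_in euclidean V" "meager_in euclidean (V - A z)"
      using ao[OF z] nonmeager[OF z] by (rule almost_open_nonmeager)
    have "V \<noteq> {}" using V(2) meager_in_empty by metis
    then obtain x where "x \<in> V" by blast
    then obtain n where "x \<in> B n" "B n \<subseteq> V" using B(2) V(1) by blast
    moreover from this have "meager_in euclidean (B n - A z)"
      by (intro meager_in_subset[OF V(3)]) auto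
    ultimately show ?thesis by blast
  qed
  then have "\<forall>z. \<exists>n. z \<in> Z \<longrightarrow> B n \<noteq> {} \<and> meager_in euclidean (B n - A z)" by blast
  from choice[OF this] obtain c
    where c: "\<And>z. z \<in> Z \<Longrightarrow> B (c z) \<noteq> {} \<and> meager_in euclidean (B (c z) - A z)" by blast
  have "inj_on c Z"
  proof (rule inj_onI, rule ccontr)
    fix y z assume yz: "y \<in> Z" "z \<in> Z" "c y = c z" "y \<noteq> z"
    have "meager_in euclidean ((B (c y) - A y) \<union> (B (c z) - A z))"
      using c[OF yz(1)] c[OF yz(2)] by (intro meager_in_Un) blast+
    then have "meager_in euclidean (B (c y))"
      by (rule meager_in_subset) (use disj[OF yz(1,2,4)] yz(3) in auto)
    then show False
      using c[OF yz(1)] B(1)[of "c y"]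
        not_meager_open[OF completely_metrizable_space_euclidean, of "B (c y)"] by simp
  qed
  then show ?thesis by (rule countableI)
qed

text \<open>Rudin's proof of Stone's theorem: a point belongs to the first centre, in a well-order, within
  distance \<open>\<delta>\<close>, and \<open>n\<close> measures how far inside the ball it lies.\<close>

lemma sigma_disjoint_ball_refinement:
  fixes \<delta> :: real
  assumes "\<delta> > 0"
  obtains V :: "nat \<Rightarrow> 'b::metric_space \<Rightarrow> 'b set"
  where "\<And>n z. open (V n z)" "\<And>n z. V n z \<subseteq> ball z \<delta>"
    "\<And>n y z. y \<noteq> z \<Longrightarrow> V n y \<inter> V n z = {}" "\<And>v. \<exists>n z. v \<in> V n z"
proof -
  obtain r :: "'b rel" where r: "well_order_on UNIV r"
    using well_order_on by blast
  let ?R = "r - Id"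
  have wf: "wf ?R" using r by (simp add: well_order_on_def)
  have total: "y = z \<or> (y, z) \<in> ?R \<or> (z, y) \<in> ?R" for y z
    using r by (auto simp: well_order_on_def linear_order_on_def total_on_def)
  define e where "e n = inverse (real (Suc n))" for n
  have e_pos: "e n > 0" for n by (simp add: e_def)
  \<comment> \<open>If \<open>y\<close> precedes \<open>z\<close>, points of \<open>C n y\<close>
    are closer to \<open>y\<close> than \<open>\<delta> - e n\<close>, while points of
    \<open>C n z\<close> are at least \<open>\<delta>\<close> away from \<open>y\<close>. The two
    sets are thus more than \<open>e n\<close> apart, and balls of radius \<open>e n / 2\<close>
    around their points stay disjoint.\<close>
  define C where "C n z = {w. dist w z < \<delta> - e n \<and> (\<forall>y. (y, z) \<in> ?R \<longrightarrow> dist w y \<ge> \<delta>)}" for n z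
  define V where "V n z = (\<Union>w\<in>C n z. ball w (e n / 2))" for n z
  have "V n y \<inter> V n z = {}" if "(y, z) \<in> ?R" for n y z
  proof (rule ccontr)
    assume "V n y \<inter> V n z \<noteq> {}"
    then obtain v w w' where w: "w \<in> C n y" "dist w v < e n / 2" "w' \<in> C n z" "dist w' v < e n / 2"
      by (auto simp: V_def)
    have "dist w y < \<delta> - e n" "dist w' y \<ge> \<delta>"
      using w(1,3) that unfolding C_def by blast+
    moreover have "dist w' y \<le> dist w' v + dist v w + dist w y"
      by (smt (verit) dist_triangle)
    ultimately show False
      using w(2,4) by (simp add: dist_commute)
  qed
  then have disj: "V n y \<inter> V n z = {}" if "y \<noteq> z" for n y z
    using total[of y z] that by blast
  have sub: "V n z \<subseteq> ball z \<delta>" for n z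
  proof
    fix v assume "v \<in> V n z"
    then obtain w where "dist w z < \<delta> - e n" "dist w v < e n / 2"
      by (auto simp: V_def C_def)
    moreover have "dist z v \<le> dist w z + dist w v"
      by (metis dist_commute dist_triangle)
    ultimately show "v \<in> ball z \<delta>"
      using e_pos[of n] by simp
  qed
  have cover: "\<exists>n z. v \<in> V n z" for v
  proof -
    have "v \<in> {z. dist v z < \<delta>}" using assms by simp
    from wfE_min[OF wf this] obtain z where z: "dist v z < \<delta>" "\<forall>y. (y, z) \<in> ?R \<longrightarrow> \<not> dist v y < \<delta>"
      by (metis mem_Collect_eq)
    obtain n where "e n < \<delta> - dist v z"
      unfolding e_def using z(1) reals_Archimedean[of "\<delta> - dist v z"] by auto
    then have "v \<in> C n z"
      using z(2) by (simp add: C_def not_less)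
    then have "v \<in> V n z"
      using e_pos[of n] unfolding V_def by (intro UN_I) auto
    then show ?thesis by blast
  qed
  have "open (V n z)" for n z
    by (auto simp: V_def)
  then show thesis using that sub disj cover by metis
qed

text \<open>For fixed \<open>\<delta>\<close>, each level of a sigma-disjoint refinement has only
  countably many pieces with nonmeager preimage; their centres form a countable net. The remaining
  pieces have meager preimages whose union is again meager, because any union of pieces is open and
  so has a preimage with the Baire property.\<close>

lemma essentially_separable_range:
  fixes f :: "'a::polish_space \<Rightarrow> 'b::metric_space"
  assumes f: "has_baire_property f"
  obtains R where "countable R" "meager_in euclidean {x. f x \<notin> closure R}"
proof -
  have net: "\<exists>R. countable R \<and> meager_in euclidean {x. \<forall>z\<in>R. dist (f x) z \<ge> \<delta>}" if "\<delta> > 0" for \<delta>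
  proof -
    obtain V :: "nat \<Rightarrow> 'b \<Rightarrow> 'b set" where V: "\<And>n z. open (V n z)" "\<And>n z. V n z \<subseteq> ball z \<delta>"
      "\<And>n y z. y \<noteq> z \<Longrightarrow> V n y \<inter> V n z = {}" "\<And>v. \<exists>n z. v \<in> V n z"
      using \<open>\<delta> > 0\<close> by (rule sigma_disjoint_ball_refinement) blast
    define Z where "Z n = {z. \<not> meager_in euclidean (f -` V n z)}" for n
    have Z: "countable (Z n)" for n
    proof (rule countable_disjoint_nonmeager)
      show "almost_open (f -` V n z)" for z
        using f V(1) by (rule almost_open_vimage)
      show "f -` V n y \<inter> f -` V n z = {}" if "y \<noteq> z" for y z
        using V(3)[OF that] by blast
    qed (simp add: Z_def)
    define W where "W n = {x. \<exists>z. z \<notin> Z n \<and> f x \<in> V n z}" for n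
    have W: "meager_in euclidean (W n)" for n
    proof -
      define g where "g x = (THE z. f x \<in> V n z)" for x
      have g: "g x = z" if "f x \<in> V n z" for x z
        unfolding g_def using that V(3)[of _ z n] by (intro the_equality) blast+
      show ?thesis
      proof (rule meager_domain_of_meager_fibres)
        fix S
        have "{x \<in> W n. g x \<in> S} = f -` (\<Union>z\<in>S - Z n. V n z)"
          using g by (auto simp: W_def)
        then show "almost_open {x \<in> W n. g x \<in> S}"
          using almost_open_vimage[OF f open_UN, of "S - Z n" "V n"] V(1) by simp
      next
        fix z
        have "{x \<in> W n. g x = z} \<subseteq> (if z \<in> Z n then {} else f -` V n z)"
          using g by (auto simp: W_def)
        moreover have "meager_in euclidean (if z \<in> Z n then {} else f -` V n z)"
          by (simp add: Z_def meager_in_empty)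
        ultimately show "meager_in euclidean {x \<in> W n. g x = z}"
          by (rule meager_in_subset[rotated])
      qed
    qed
    have "{x. \<forall>z\<in>(\<Union>n. Z n). dist (f x) z \<ge> \<delta>} \<subseteq> (\<Union>n. W n)"
    proof
      fix x assume x: "x \<in> {x. \<forall>z\<in>(\<Union>n. Z n). dist (f x) z \<ge> \<delta>}"
      obtain n z where nz: "f x \<in> V n z" using V(4) by blast
      then have "dist (f x) z < \<delta>" using V(2)[of n z] by (auto simp: dist_commute)
      then have "z \<notin> Z n" using x by force
      with nz show "x \<in> (\<Union>n. W n)" unfolding W_def by blast
    qed
    then have "meager_in euclidean {x. \<forall>z\<in>(\<Union>n. Z n). dist (f x) z \<ge> \<delta>}"
      using meager_in_UN_nat[OF W] by (rule meager_in_subset[rotated])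
    moreover have "countable (\<Union>n. Z n)" using Z by blast
    ultimately show ?thesis by blast
  qed
  have "\<forall>n. \<exists>R. countable R \<and> meager_in euclidean {x. \<forall>z\<in>R. dist (f x) z \<ge> inverse (real (Suc n))}"
    by (intro allI net) simp
  from choice[OF this] obtain R where R: "\<And>n. countable (R n)"
    "\<And>n. meager_in euclidean {x. \<forall>z\<in>R n. dist (f x) z \<ge> inverse (real (Suc n))}" by blast
  have "{x. f x \<notin> closure (\<Union>n. R n)} \<subseteq> (\<Union>n. {x. \<forall>z\<in>R n. dist (f x) z \<ge> inverse (real (Suc n))})"
  proof
    fix x assume "x \<in> {x. f x \<notin> closure (\<Union>n. R n)}"
    then obtain \<epsilon> where \<epsilon>: "\<epsilon> > 0" "\<And>z. z \<in> (\<Union>n. R n) \<Longrightarrow> \<not> dist z (f x) < \<epsilon>"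
      unfolding closure_approachable by blast
    obtain n where "inverse (real (Suc n)) < \<epsilon>"
      using \<epsilon>(1) reals_Archimedean by blast
    then have "\<forall>z\<in>R n. dist (f x) z \<ge> inverse (real (Suc n))"
      using \<epsilon>(2) by (force simp: dist_commute)
    then show "x \<in> (\<Union>n. {x. \<forall>z\<in>R n. dist (f x) z \<ge> inverse (real (Suc n))})" by blast
  qed
  then have "meager_in euclidean {x. f x \<notin> closure (\<Union>n. R n)}"
    using meager_in_UN_nat[OF R(2)] by (rule meager_in_subset[rotated])
  moreover have "countable (\<Union>n. R n)" using R(1) by blast
  ultimately show thesis using that by blast
qed

text \<open>If the range is not separable, \<open>x \<mapsto> (f x, g x)\<close> need not have the Baire property a priori,
  because open sets of the square are not countable unions of open rectangles.\<close>

lemma almost_open_dist_ge: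
  fixes f g :: "'a::polish_space \<Rightarrow> 'b::metric_space"
  assumes f: "has_baire_property f" and g: "has_baire_property g"
  shows "almost_open {x. dist (f x) (g x) \<ge> e}"
proof -
  obtain R where R: "countable R" "meager_in euclidean {x. f x \<notin> closure R}" (is "meager_in _ ?M")
    using f by (rule essentially_separable_range)
  \<comment> \<open>\<open>r\<close> is a point of \<open>R\<close> close to \<open>f x\<close>, and
    the rational \<open>q\<close> splits the distance \<open>e\<close> between the two halves of the
    triangle inequality. Approximating the values of one of the two functions suffices.\<close>
  let ?L = "\<Union>r\<in>R. \<Union>q\<in>\<rat>. f -` ball r q \<inter> g -` ball r (e - q)"
  have "almost_open ?L"
    using R(1) countable_rat f g
    by (intro almost_open_UN almost_open_Int almost_open_vimage) auto
  moreover have "?L - ?M = {x. dist (f x) (g x) < e} - ?M"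
  proof (intro equalityI subsetI)
    fix x assume "x \<in> ?L - ?M"
    then obtain r q where "dist r (f x) < q" "dist r (g x) < e - q" "x \<notin> ?M"
      by auto
    moreover from this have "dist (f x) (g x) < e"
      using dist_triangle[of "f x" "g x" r] by (simp add: dist_commute)
    ultimately show "x \<in> {x. dist (f x) (g x) < e} - ?M" by blast
  next
    fix x assume x: "x \<in> {x. dist (f x) (g x) < e} - ?M"
    define \<eta> where "\<eta> = e - dist (f x) (g x)"
    have "\<eta> > 0" using x by (simp add: \<eta>_def)
    then obtain r where r: "r \<in> R" "dist r (f x) < \<eta> / 2"
      using x closure_approachable[of "f x" R] by (auto dest: spec[of _ "\<eta> / 2"])
    then obtain q where q: "q \<in> \<rat>" "dist r (f x) < q" "q < \<eta> / 2"
      using Rats_dense_in_real by blast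
    have "dist r (g x) \<le> dist r (f x) + dist (f x) (g x)"
      by (rule dist_triangle)
    then have "dist r (g x) < e - q"
      using q r by (simp add: \<eta>_def)
    with r q x show "x \<in> ?L - ?M" by auto
  qed
  ultimately have "almost_open {x. dist (f x) (g x) < e}"
    using almost_open_cong_meager[OF _ R(2)] by blast
  from almost_open_Compl[OF this] show ?thesis
    by (simp add: Compl_eq not_less)
qed


section \<open>Divergence along increasing index sequences\<close>

lemma incr_seqs_strict_mono: "s \<in> incr_seqs \<longleftrightarrow> strict_mono s"
  by (simp add: incr_seqs_def strict_mono_Suc_iff)

lemma closed_incr_seqs: "closed incr_seqs"
proof -
  have "continuous_on UNIV Suc"
    by (simp add: continuous_on_open_vimage open_discrete)
  from continuous_on_compose2[OF this continuous_on_product_coordinates]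
  have "continuous_on UNIV (\<lambda>s :: nat \<Rightarrow> nat. Suc (s n))" for n
    by simp
  then have "closed {s :: nat \<Rightarrow> nat. Suc (s n) \<le> s (Suc n)}" for n
    by (intro closed_Collect_le continuous_on_product_coordinates)
  then have "closed (\<Inter>n. {s :: nat \<Rightarrow> nat. Suc (s n) \<le> s (Suc n)})"
    by (intro closed_INT ballI)
  moreover have "incr_seqs = (\<Inter>n. {s. Suc (s n) \<le> s (Suc n)})"
    by (simp add: incr_seqs_def Suc_le_eq set_eq_iff)
  ultimately show ?thesis by simp
qed

lemma completely_metrizable_incr_seqs: "completely_metrizable_space (top_of_set incr_seqs)"
  using completely_metrizable_space_closedin[OF completely_metrizable_discrete_sequences]
    closed_incr_seqs by simp

lemma nonempty_incr_seqs: "incr_seqs \<noteq> {}"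
proof -
  have "(\<lambda>n. n) \<in> incr_seqs" by (simp add: incr_seqs_def)
  then show ?thesis by blast
qed

section \<open>Convergence and ideal convergence of a single sequence\<close>

lemma convergent_imp_ideal_convergent:
  assumes I: "admissible_ideal I" and "convergent u"
  shows "ideal_convergent I u"
proof -
  obtain z where z: "u \<longlonglongrightarrow> z" using assms(2) by (auto simp: convergent_def)
  have "{n. dist (u n) z \<ge> e} \<in> I" if "e > 0" for e
  proof -
    obtain N where "\<forall>n\<ge>N. dist (u n) z < e"
      using z \<open>e > 0\<close> by (auto simp: lim_sequentially)
    then have "{n. dist (u n) z \<ge> e} \<subseteq> {..<N}"
      by (auto simp: not_le[symmetric])
    then have "finite {n. dist (u n) z \<ge> e}"
      by (rule finite_subset) simp
    then show ?thesis using I by (simp add: admissible_ideal_def)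
  qed
  then show ?thesis by (auto simp: ideal_convergent_def ideal_convergent_to_def)
qed

text \<open>The indices with values at least \<open>e / 2\<close> away from the ideal limit form a
  set in \<open>I\<close>. It is not everything, which yields \<open>N\<close>, and it contains no
  late block, which yields \<open>n\<close>.\<close>

lemma ideal_convergent_imp_close:
  assumes I: "admissible_ideal I"
    and m: "\<And>A. A \<in> I \<Longrightarrow> \<exists>K. \<forall>k\<ge>K. \<not> {m k..<m (Suc k)} \<subseteq> A"
    and u: "ideal_convergent I u" and e: "e > 0"
  shows "\<exists>N K. \<forall>k\<ge>K. \<exists>n\<in>{m k..<m (Suc k)}. dist (u n) (u N) < e"
proof -
  obtain z where z: "\<And>e. e > 0 \<Longrightarrow> {n. dist (u n) z \<ge> e} \<in> I"
    using u by (auto simp: ideal_convergent_def ideal_convergent_to_def)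
  let ?A = "{n. dist (u n) z \<ge> e / 2}"
  have A: "?A \<in> I" by (rule z) (use e in simp)
  then have "?A \<noteq> UNIV" using I by (auto simp: admissible_ideal_def)
  then obtain N where N: "dist (u N) z < e / 2" using not_le by blast
  obtain K where K: "\<And>k. k \<ge> K \<Longrightarrow> \<not> {m k..<m (Suc k)} \<subseteq> ?A"
    using m[OF A] by blast
  have "\<exists>n\<in>{m k..<m (Suc k)}. dist (u n) (u N) < e" if "k \<ge> K" for k
  proof -
    obtain n where n: "n \<in> {m k..<m (Suc k)}" "dist (u n) z < e / 2"
      using K[of k] \<open>k \<ge> K\<close> not_le by blast
    have "dist (u n) (u N) < e"
      using n(2) N by (rule dist_triangle_half_l)
    with n(1) show ?thesis by blast
  qed
  then show ?thesis by blast
qed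

text \<open>Completeness enters here: if tails fit into arbitrarily small balls, the sequence is
  Cauchy. The centre \<open>z\<close> is left free because it is later taken to be a value
  \<open>f (s N) x\<close>.\<close>

lemma not_convergent_imp_far:
  fixes u :: "nat \<Rightarrow> 'b::complete_space"
  assumes "\<not> convergent u"
  shows "\<exists>e>0. \<forall>z m. \<exists>i\<ge>m. dist (u i) z \<ge> e"
proof (rule ccontr)
  assume *: "\<not> ?thesis"
  have "Cauchy u"
    unfolding Cauchy_altdef
  proof (intro allI impI)
    fix e :: real assume "e > 0"
    then have "e / 2 > 0" by simp
    with * obtain z m where zm: "\<And>i. i \<ge> m \<Longrightarrow> dist (u i) z < e / 2"
      by (meson not_le)
    then have "dist (u i) (u j) < e" if "i \<ge> m" "j \<ge> m" for i j
      using that by (meson dist_triangle_half_l)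
    then show "\<exists>M. \<forall>m\<ge>M. \<forall>n>m. dist (u m) (u n) < e"
      by (meson less_imp_le order_trans)
  qed
  with assms show False by (simp add: Cauchy_convergent)
qed

lemma extend_strict_mono:
  fixes s :: "nat \<Rightarrow> nat"
  assumes s: "strict_mono s" and P: "\<And>m. \<exists>i\<ge>m. P i"
  obtains t where "strict_mono t" "\<And>n. n < L \<Longrightarrow> t n = s n" "\<And>n. n \<ge> L \<Longrightarrow> P (t n)"
proof -
  obtain c where c: "\<And>m. c m \<ge> m" "\<And>m. P (c m)"
    using P by metis
  \<comment> \<open>Starting from \<open>c (s L)\<close> keeps the junction strict, since the last
    retained value lies below \<open>s L\<close>; \<open>Suc w\<close> keeps the continuation
    strict.\<close>
  define v where "v = rec_nat (c (s L)) (\<lambda>_ w. c (Suc w))"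
  have v: "v 0 = c (s L)" "\<And>k. v (Suc k) = c (Suc (v k))" by (simp_all add: v_def)
  have Pv: "P (v k)" for k by (cases k) (simp_all add: v c)
  define t where "t n = (if n < L then s n else v (n - L))" for n
  have "t n < t (Suc n)" for n
  proof -
    consider "Suc n < L" | "Suc n = L" | "n \<ge> L" by linarith
    then show ?thesis
    proof cases
      case 1
      then show ?thesis using s by (simp add: t_def strict_mono_Suc_iff)
    next
      case 2
      have "s n < s L" using s 2 by (simp add: strict_mono_less)
      also have "\<dots> \<le> c (s L)" by (rule c)
      finally show ?thesis using 2 by (auto simp: t_def v)
    next
      case 3
      have "v (n - L) < c (Suc (v (n - L)))" using c(1) Suc_le_lessD by blast
      then show ?thesis using 3 by (simp add: t_def Suc_diff_le v)
    qed
  qed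
  then have "strict_mono t" by (simp add: strict_mono_Suc_iff)
  then show thesis using that[of t] Pv by (simp add: t_def)
qed

text \<open>A finite initial segment of \<open>s\<close> can be extended so that on a whole block \<open>{m k..<m (Suc k)}\<close> the
  values \<open>f (s n) x\<close> stay away from \<open>f (s N) x\<close>; replacing the sets
  \<open>{x. dist (f i x) (f j x) \<ge> e}\<close> by open sets \<open>U i j\<close> makes this an open condition in \<open>x\<close>.\<close>

lemma nowhere_dense_close_on_blocks:
  fixes f :: "nat \<Rightarrow> 'a::topological_space \<Rightarrow> 'b::metric_space"
  assumes m: "strict_mono m" and U: "\<And>i j. open (U i j)"
    and D: "\<And>x i j. x \<in> D \<Longrightarrow> x \<in> U i j \<longleftrightarrow> dist (f i x) (f j x) \<ge> e"
      "\<And>x z M. x \<in> D \<Longrightarrow> \<exists>i\<ge>M. dist (f i x) z \<ge> e"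
  shows "nowhere_dense_in (prod_topology euclidean (top_of_set incr_seqs))
    {(x, s). x \<in> D \<and> s \<in> incr_seqs \<and>
      (\<forall>k\<ge>K. \<exists>n\<in>{m k..<m (Suc k)}. dist (f (s n) x) (f (s N) x) < e)}"
    (is "nowhere_dense_in ?T ?E")
proof (rule nowhere_dense_inI)
  show "?E \<subseteq> topspace ?T" by auto
next
  fix G assume G: "openin ?T G" "G \<noteq> {}"
  obtain x0 s0 where "(x0, s0) \<in> G" using G(2) by auto
  then obtain V W where VW: "open V" "openin (top_of_set incr_seqs) W" "x0 \<in> V" "s0 \<in> W" "V \<times> W \<subseteq> G"
    using G(1) unfolding openin_prod_topology_alt open_openin[symmetric] by metis
  show "\<exists>G'. openin ?T G' \<and> G' \<noteq> {} \<and> G' \<subseteq> G \<and> G' \<inter> ?E = {}"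
  proof (cases "V \<inter> D = {}")
    case True
    then have "V \<times> W \<inter> ?E = {}" by blast
    moreover have "openin ?T (V \<times> W)"
      using VW(1,2) by (auto simp: openin_prod_Times_iff)
    ultimately show ?thesis using VW by blast
  next
    case False
    then obtain x where x: "x \<in> V" "x \<in> D" by blast
    obtain W' where W': "open W'" "W = incr_seqs \<inter> W'"
      using VW(2) by (auto simp: openin_open)
    then obtain l where l: "cylinder s0 l \<subseteq> W'"
      using cylinder_subset_open VW(4) by (metis IntE)
    have s0: "strict_mono s0" using VW(4) W' by (simp add: incr_seqs_strict_mono)
    \<comment> \<open>Since \<open>m k\<close> is at least \<open>k\<close>, the block starts beyond
      the \<open>l\<close> entries prescribed by the neighbourhood and beyond \<open>N\<close>;
      since \<open>k\<close> is at least \<open>K\<close>, \<open>?E\<close> imposes a condition on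
      it.\<close>
    define k where "k = max K (max l (Suc N))"
    have mk: "m k \<ge> l" "m k > N"
      using strict_mono_imp_increasing[OF m, of k] by (auto simp: k_def)
    obtain t where t: "strict_mono t" "\<And>n. n < m k \<Longrightarrow> t n = s0 n"
      "\<And>n. n \<ge> m k \<Longrightarrow> dist (f (t n) x) (f (s0 N) x) \<ge> e"
      using extend_strict_mono[OF s0, of "\<lambda>i. dist (f i x) (f (s0 N) x) \<ge> e" "m k"] D(2)[OF x(2)]
      by metis
    have tN: "t N = s0 N" using t(2) mk(2) by simp
    \<comment> \<open>Finitely many open conditions on the point, and a cylinder that fixes the
      index sequence at \<open>N\<close> and on the whole block.\<close>
    let ?V = "V \<inter> (\<Inter>n\<in>{m k..<m (Suc k)}. U (t n) (t N))"
    let ?W = "incr_seqs \<inter> cylinder t (m (Suc k))"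
    have less: "m k < m (Suc k)" using m by (simp add: strict_mono_Suc_iff)
    have "open ?V" using VW(1) U by (intro open_Int open_INT) auto
    moreover have "openin (top_of_set incr_seqs) ?W"
      by (intro openin_open_Int open_cylinder)
    ultimately have op: "openin ?T (?V \<times> ?W)"
      by (simp add: openin_prod_Times_iff)
    have "x \<in> ?V" using x D(1)[OF x(2)] t(3) tN by simp
    moreover have "t \<in> ?W"
      using t(1) by (simp add: incr_seqs_strict_mono cylinder_def)
    ultimately have ne: "?V \<times> ?W \<noteq> {}" by blast
    have "?W \<subseteq> cylinder s0 l"
      using t(2) mk(1) less by (auto simp: cylinder_def)
    then have sub: "?V \<times> ?W \<subseteq> G"
      using VW(5) W' l by blast
    have "(y, s) \<notin> ?E" if ys: "(y, s) \<in> ?V \<times> ?W" for y s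
    proof
      assume E: "(y, s) \<in> ?E"
      moreover have "k \<ge> K" by (simp add: k_def)
      ultimately obtain n where n: "n \<in> {m k..<m (Suc k)}" "dist (f (s n) y) (f (s N) y) < e"
        by blast
      have "s n = t n" "s N = t N"
        using ys n(1) mk(2) less by (auto simp: cylinder_def)
      moreover have "y \<in> U (t n) (t N)" "y \<in> D" using ys n(1) E by auto
      ultimately show False using D(1)[of y "t n" "t N"] n(2) by simp
    qed
    then have "(?V \<times> ?W) \<inter> ?E = {}" by blast
    with op ne sub show ?thesis by blast
  qed
qed

text \<open>Off the meager set of points that converge or lie in \<open>M\<close>, divergence of
  \<open>f n x\<close> supplies a scale \<open>p\<close>, and ideal convergence along
  \<open>s\<close> supplies \<open>N\<close> and \<open>K\<close> with
  \<open>(x, s) \<in> E p N K\<close>.\<close>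

lemma meager_ideal_convergent_product:
  fixes f :: "nat \<Rightarrow> 'a::polish_space \<Rightarrow> 'b::complete_space"
  assumes f: "\<And>n. has_baire_property (f n)" and I: "admissible_ideal I"
    and meager: "meager_in euclidean (char_funs I)"
    and C: "meager_in euclidean {x. convergent (\<lambda>n. f n x)}"
  shows "meager_in (prod_topology euclidean (top_of_set incr_seqs))
    {(x, s). s \<in> incr_seqs \<and> ideal_convergent I (\<lambda>n. f (s n) x)}" (is "meager_in ?T ?A")
proof -
  obtain m :: "nat \<Rightarrow> nat" where m: "strict_mono m"
    "\<And>A. A \<in> I \<Longrightarrow> \<exists>K. \<forall>k\<ge>K. \<not> {m k..<m (Suc k)} \<subseteq> A"
    using I meager by (rule meager_ideal_intervals) blast
  define e where "e p = inverse (real (Suc p))" for p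
  have e: "e p > 0" for p by (simp add: e_def)
  \<comment> \<open>\<open>q\<close> codes a scale and two indices; its type is countable, so the
    errors of all open approximations fit into the one meager set \<open>M\<close>.\<close>
  let ?F = "\<lambda>q. {x. dist (f (fst (snd q)) x) (f (snd (snd q)) x) \<ge> e (fst q)}"
  have "\<forall>q. \<exists>U. open U \<and> meager_in euclidean ((?F q - U) \<union> (U - ?F q))"
    using almost_open_dist_ge[OF f f] unfolding almost_open_def by blast
  from choice[OF this] obtain U
    where U: "\<And>q. open (U q)" "\<And>q. meager_in euclidean ((?F q - U q) \<union> (U q - ?F q))" by blast
  define M where "M = (\<Union>q. (?F q - U q) \<union> (U q - ?F q))"
  have M: "meager_in euclidean M"
    unfolding M_def using U(2) by (intro meager_in_UN) auto
  define D where "D p = {x. \<forall>z m. \<exists>i\<ge>m. dist (f i x) z \<ge> e p} - M" for p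
  define E where "E p N K = {(x, s). x \<in> D p \<and> s \<in> incr_seqs \<and>
    (\<forall>k\<ge>K. \<exists>n\<in>{m k..<m (Suc k)}. dist (f (s n) x) (f (s N) x) < e p)}" for p N K
  have "nowhere_dense_in ?T (E p N K)" for p N K
    unfolding E_def
  proof (rule nowhere_dense_close_on_blocks[OF m(1), where U = "\<lambda>i j. U (p, i, j)"])
    fix x i j assume "x \<in> D p"
    then have "x \<notin> (?F (p, i, j) - U (p, i, j)) \<union> (U (p, i, j) - ?F (p, i, j))"
      unfolding D_def M_def by blast
    then show "x \<in> U (p, i, j) \<longleftrightarrow> dist (f i x) (f j x) \<ge> e p"
      by auto
  qed (simp_all add: U D_def)
  then have E: "meager_in ?T (\<Union>p. \<Union>N. \<Union>K. E p N K)"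
    by (intro meager_in_UN_nat nowhere_dense_imp_meager)
  let ?B = "({x. convergent (\<lambda>n. f n x)} \<union> M) \<times> topspace (top_of_set incr_seqs)"
  have "?A \<subseteq> ?B \<union> (\<Union>p. \<Union>N. \<Union>K. E p N K)"
  proof (rule subrelI)
    fix x s assume "(x, s) \<in> ?A"
    then have s: "s \<in> incr_seqs" and conv: "ideal_convergent I (\<lambda>n. f (s n) x)" by auto
    show "(x, s) \<in> ?B \<union> (\<Union>p. \<Union>N. \<Union>K. E p N K)"
    proof (cases "convergent (\<lambda>n. f n x) \<or> x \<in> M")
      case True
      with s show ?thesis by auto
    next
      case False
      then obtain \<epsilon> where \<epsilon>: "\<epsilon> > 0" "\<And>z m. \<exists>i\<ge>m. dist (f i x) z \<ge> \<epsilon>"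
        using not_convergent_imp_far[of "\<lambda>n. f n x"] by blast
      obtain p where p: "e p < \<epsilon>"
        unfolding e_def using \<epsilon>(1) reals_Archimedean by blast
      have "\<exists>i\<ge>m. dist (f i x) z \<ge> e p" for z m
        using \<epsilon>(2)[of m z] p by (meson less_imp_le order_trans)
      then have "x \<in> D p" using False by (simp add: D_def)
      moreover obtain N K where "\<forall>k\<ge>K. \<exists>n\<in>{m k..<m (Suc k)}. dist (f (s n) x) (f (s N) x) < e p"
        using ideal_convergent_imp_close[OF I m(2) conv e] by blast
      ultimately have "(x, s) \<in> E p N K" using s by (simp add: E_def)
      then show ?thesis by blast
    qed
  qed
  moreover have "meager_in ?T (?B \<union> (\<Union>p. \<Union>N. \<Union>K. E p N K))"
    by (intro meager_in_Un[OF meager_in_Times E] meager_in_Un C M)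
  ultimately show ?thesis by (rule meager_in_subset[rotated])
qed

text \<open>A section of a closed set \<open>N n\<close> that is not nowhere dense contains some
  nonempty \<open>B k\<close>, so its parameter lies in \<open>F n k\<close>. That set is nowhere
  dense: an open subset of \<open>B k \<times> V\<close> missing \<open>N n\<close> projects to an
  open subset of \<open>V\<close> missing \<open>F n k\<close>.\<close>

lemma comeager_meager_sections:
  fixes A :: "('a::second_countable_topology \<times> 'c) set"
  assumes "meager_in (prod_topology euclidean T) A"
  shows "comeager_in T {s \<in> topspace T. meager_in euclidean {x. (x, s) \<in> A}}"
proof -
  obtain B :: "nat \<Rightarrow> 'a set" where B: "\<And>n. open (B n)"
    "\<And>U x. open U \<Longrightarrow> x \<in> U \<Longrightarrow> \<exists>n. x \<in> B n \<and> B n \<subseteq> U"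
    by (rule countable_base_seq) blast
  obtain N :: "nat \<Rightarrow> _" where N: "\<And>n. closedin (prod_topology euclidean T) (N n)"
    "\<And>n. nowhere_dense_in (prod_topology euclidean T) (N n)" "A \<subseteq> (\<Union>n. N n)"
    using assms by (rule meager_in_fsigma_hull) blast
  define F where "F n k = {s \<in> topspace T. B k \<noteq> {} \<and> (\<forall>x\<in>B k. (x, s) \<in> N n)}" for n k
  have F: "nowhere_dense_in T (F n k)" for n k
  proof (rule nowhere_dense_inI)
    fix V assume V: "openin T V" "V \<noteq> {}"
    show "\<exists>V'. openin T V' \<and> V' \<noteq> {} \<and> V' \<subseteq> V \<and> V' \<inter> F n k = {}"
    proof (cases "B k = {}")
      case True
      with V show ?thesis by (auto simp: F_def)
    next
      case False
      have "openin (prod_topology euclidean T) (B k \<times> V)" "B k \<times> V \<noteq> {}"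
        using V False B(1) by (auto simp: openin_prod_Times_iff)
      then obtain G where G: "openin (prod_topology euclidean T) G" "G \<noteq> {}" "G \<subseteq> B k \<times> V" "G \<inter> N n = {}"
        using nowhere_dense_inD[OF N(2)] by metis
      have "openin T (snd ` G)"
        using open_map_snd G(1) unfolding open_map_def by blast
      moreover have "snd ` G \<inter> F n k = {}"
        using G(3,4) by (force simp: F_def)
      moreover have "snd ` G \<subseteq> V" using G(3) by auto
      ultimately show ?thesis using G(2) by (intro exI[of _ "snd ` G"]) simp
    qed
  qed (auto simp: F_def)
  have "meager_in euclidean {x. (x, s) \<in> A}" if s: "s \<in> topspace T" "s \<notin> (\<Union>n. \<Union>k. F n k)" for s
  proof -
    have "nowhere_dense_in euclidean {x. (x, s) \<in> N n}" for n
    proof (rule nowhere_dense_inI)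
      fix V :: "'a set" assume V: "openin euclidean V" "V \<noteq> {}"
      then obtain x where "x \<in> V" by blast
      then obtain k where k: "x \<in> B k" "B k \<subseteq> V" using B(2)[of V x] V by auto
      then obtain y where y: "y \<in> B k" "(y, s) \<notin> N n"
        using s unfolding F_def by blast
      have op: "openin (prod_topology euclidean T) (topspace (prod_topology euclidean T) - N n)"
        using N(1) by blast
      then obtain P Q where PQ: "openin euclidean P" "openin T Q" "y \<in> P" "s \<in> Q"
        "P \<times> Q \<subseteq> topspace (prod_topology euclidean T) - N n"
      proof -
        have "(y, s) \<in> topspace (prod_topology euclidean T) - N n"
          using y s by simp
        with op show thesis
          unfolding openin_prod_topology_alt using that by blast
      qed
      have "open (B k \<inter> P)" using B(1) PQ(1) by auto
      then show "\<exists>V'. openin euclidean V' \<and> V' \<noteq> {} \<and> V' \<subseteq> V \<and> V' \<inter> {x. (x, s) \<in> N n} = {}"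
        using y k PQ by (intro exI[of _ "B k \<inter> P"]) auto
    qed simp
    then have "meager_in euclidean (\<Union>n. {x. (x, s) \<in> N n})"
      by (intro meager_in_UN_nat nowhere_dense_imp_meager)
    then show ?thesis by (rule meager_in_subset) (use N(3) in blast)
  qed
  then have "topspace T - {s \<in> topspace T. meager_in euclidean {x. (x, s) \<in> A}} \<subseteq> (\<Union>n. \<Union>k. F n k)"
    by blast
  moreover have "meager_in T (\<Union>n. \<Union>k. F n k)"
    using F by (intro meager_in_UN_nat nowhere_dense_imp_meager)
  ultimately show ?thesis
    unfolding comeager_in_def by (auto intro: meager_in_subset)
qed

section \<open>Sections and the equivalences\<close>

lemma comeager_meager_sections_if_comeager_divergent:
  fixes f :: "nat \<Rightarrow> 'a::polish_space \<Rightarrow> 'b::complete_space"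
  assumes "\<And>n. has_baire_property (f n)" "admissible_ideal I" "meager_in euclidean (char_funs I)"
    and "meager_in euclidean {x. convergent (\<lambda>n. f n x)}"
  shows "comeager_in (top_of_set incr_seqs)
    {s \<in> incr_seqs. meager_in euclidean {x. ideal_convergent I (\<lambda>n. f (s n) x)}}"
proof -
  have "comeager_in (top_of_set incr_seqs) {s \<in> topspace (top_of_set incr_seqs).
      meager_in euclidean {x. (x, s) \<in> {(x, s). s \<in> incr_seqs \<and> ideal_convergent I (\<lambda>n. f (s n) x)}}}"
    using assms by (intro comeager_meager_sections meager_ideal_convergent_product)
  then show ?thesis
    by (simp cong: conj_cong)
qed

lemma has_baire_property_const: "has_baire_property (\<lambda>x. c)"
proof -
  have "(\<lambda>x. c) -` U \<in> {U. openin euclidean U}" for U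
    by (cases "c \<in> U") auto
  then show ?thesis
    unfolding has_baire_property_def baire_sets_def by (blast intro: sigma_sets.Basic)
qed

text \<open>Applied to the constant functions with values \<open>u n\<close>, the preceding lemma concerns a single
  sequence: all sections are empty or the whole space, which is not meager.\<close>

lemma meager_ideal_convergent_subsequences:
  fixes u :: "nat \<Rightarrow> 'b::complete_space"
  assumes I: "admissible_ideal I" "meager_in euclidean (char_funs I)" and u: "\<not> convergent u"
  shows "meager_in (top_of_set incr_seqs) {s \<in> incr_seqs. ideal_convergent I (\<lambda>n. u (s n))}"
proof -
  have "comeager_in (top_of_set incr_seqs)
      {s \<in> incr_seqs. meager_in euclidean {x :: real. ideal_convergent I (\<lambda>n. u (s n))}}"
    using I u comeager_meager_sections_if_comeager_divergent[of "\<lambda>n (x :: real). u n" I]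
    by (simp add: has_baire_property_const meager_in_empty)
  moreover have "\<not> meager_in euclidean (UNIV :: real set)"
    by (rule not_meager_open[OF completely_metrizable_space_euclidean]) auto
  then have "incr_seqs - {s \<in> incr_seqs. meager_in euclidean {x :: real. ideal_convergent I (\<lambda>n. u (s n))}}
      = {s \<in> incr_seqs. ideal_convergent I (\<lambda>n. u (s n))}"
    using meager_in_empty by auto
  ultimately show ?thesis by (simp add: comeager_in_def)
qed

theorem theorem2p3:
  fixes f :: "nat \<Rightarrow> 'a::polish_space \<Rightarrow> 'b::complete_space"
    and I :: "nat set set"
  assumes baire: "\<And>n. has_baire_property (f n)"
    and ideal: "admissible_ideal I"
    and definable: "analytic (char_funs I) \<or> coanalytic (char_funs I)"
  shows
    "(comeager_in euclidean {x. \<not> convergent (\<lambda>n. f n x)} \<longleftrightarrow>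
      comeager_in euclidean
        {x. meager_in (top_of_set incr_seqs)
              {s \<in> incr_seqs. ideal_convergent I (\<lambda>n. f (s n) x)}}) \<and>
     (comeager_in euclidean
        {x. meager_in (top_of_set incr_seqs)
              {s \<in> incr_seqs. ideal_convergent I (\<lambda>n. f (s n) x)}} \<longleftrightarrow>
      meager_in (prod_topology euclidean (top_of_set incr_seqs))
        {(x, s). s \<in> incr_seqs \<and> ideal_convergent I (\<lambda>n. f (s n) x)}) \<and>
     (meager_in (prod_topology euclidean (top_of_set incr_seqs))
        {(x, s). s \<in> incr_seqs \<and> ideal_convergent I (\<lambda>n. f (s n) x)} \<longleftrightarrow>
      comeager_in (top_of_set incr_seqs)
        {s \<in> incr_seqs. meager_in euclidean {x. ideal_convergent I (\<lambda>n. f (s n) x)}})"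
    (is "(?i \<longleftrightarrow> ?ii) \<and> (?ii \<longleftrightarrow> ?iii) \<and> (?iii \<longleftrightarrow> ?iv)")
proof -
  let ?S = "top_of_set incr_seqs"
  let ?C = "{x. convergent (\<lambda>n. f n x)}"
  have Hausdorff: "Hausdorff_space (euclidean :: (nat \<Rightarrow> bool) topology)"
    using completely_metrizable_discrete_sequences
    by (intro metrizable_imp_Hausdorff_space completely_metrizable_imp_metrizable_space)
  have "almost_open (char_funs I)"
    using definable analytic_imp_almost_open[OF Hausdorff second_countable_Cantor]
      almost_open_Compl[of "- char_funs I"] by (auto simp: coanalytic_def)
  with ideal have I: "meager_in euclidean (char_funs I)"
    by (rule admissible_ideal_meager)
  have i_iff: "?i \<longleftrightarrow> meager_in euclidean ?C"
    by (simp add: comeager_in_def Compl_eq_Diff_UNIV[symmetric] Collect_neg_eq[symmetric])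
  have S: "\<not> meager_in ?S incr_seqs"
    by (rule not_meager_open[OF completely_metrizable_incr_seqs _ nonempty_incr_seqs]) auto
  have conv: "ideal_convergent I (\<lambda>n. f (s n) x)" if "x \<in> ?C" "s \<in> incr_seqs" for x s
    using convergent_subseq_convergent[of "\<lambda>n. f n x" s] that
      convergent_imp_ideal_convergent[OF ideal] by (auto simp: incr_seqs_strict_mono o_def)
  have i_ii: ?ii if ?i
  proof -
    have "UNIV - {x. meager_in ?S {s \<in> incr_seqs. ideal_convergent I (\<lambda>n. f (s n) x)}} \<subseteq> ?C"
      using meager_ideal_convergent_subsequences[OF ideal I] by blast
    then show ?thesis
      using that unfolding i_iff comeager_in_def by (auto intro: meager_in_subset)
  qed
  have ii_i: ?i if ?ii
  proof -
    have "\<not> meager_in ?S {s \<in> incr_seqs. ideal_convergent I (\<lambda>n. f (s n) x)}" if "x \<in> ?C" for x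
    proof -
      have "{s \<in> incr_seqs. ideal_convergent I (\<lambda>n. f (s n) x)} = incr_seqs"
        using conv[OF that] by blast
      with S show ?thesis by simp
    qed
    then have "?C \<subseteq> UNIV - {x. meager_in ?S {s \<in> incr_seqs. ideal_convergent I (\<lambda>n. f (s n) x)}}"
      by blast
    then show ?thesis
      using that unfolding i_iff comeager_in_def by (auto intro: meager_in_subset)
  qed
  have i_iii: ?iii if ?i
    using that meager_ideal_convergent_product[where f = f, OF baire ideal I] unfolding i_iff by blast
  have iii_iv: ?iv if ?iii
    using comeager_meager_sections[OF that] by (simp cong: conj_cong)
  \<comment> \<open>\<open>incr_seqs\<close> is not meager in itself, so a comeager subset has a
    member \<open>s\<close>. One such \<open>s\<close> suffices, because ordinary convergence of
    \<open>f n x\<close> implies ideal convergence along \<open>s\<close>.\<close>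
  have iv_i: ?i if ?iv
  proof -
    let ?G = "{s \<in> incr_seqs. meager_in euclidean {x. ideal_convergent I (\<lambda>n. f (s n) x)}}"
    have "?G \<noteq> {}"
    proof
      assume empty: "?G = {}"
      from that S show False unfolding comeager_in_def empty by simp
    qed
    then obtain s where s: "s \<in> incr_seqs"
      "meager_in euclidean {x. ideal_convergent I (\<lambda>n. f (s n) x)}" by blast
    show ?thesis
      unfolding i_iff using conv[OF _ s(1)] by (intro meager_in_subset[OF s(2)]) blast
  qed
  show ?thesis
    using i_ii ii_i i_iii iii_iv iv_i by blast
qed

end
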